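(* Let $n,d\ge 2$ be integers with $n$ even. (1) If $\phi\in\mathrm{Rat}_d$ admits an antiholomorphic automorphism $\tau$ of order $2n$, then $d\ge 3$ is odd and one of $(d-1)/n$, $(d+1)/n$ is an even integer, but not both of them. Moreover, if $r\in\{(d-1)/n,(d+1)/n\}$ is the even integer, then $\phi$ can be conjugated to a rational map of the form $\widehat\phi(z)=z\,\psi(z^n)$, with $$\psi(z)=\dfrac{\sum_{k=0}^{r} a_{k} z^{k}}{\sum_{k=0}^{r} (-1)^{k}\,\overline{a_{r-k}}\, z^{k}}\in\mathrm{Rat}_r,$$ where (i) $a_r\ne 0$, for $r=(d-1)/n$; and (ii) $a_r=0$ and $a_0\neq 0$, for $r=(d+1)/n$. In both cases, $\tau$ corresponds to $\tau_n$, where $\tau_n(z)=e^{\pi i/n}/\overline z$. (2) Assume that $d\ge 3$ is odd and that one of $(d-1)/n$, $(d+1)/n$ is an even integer, but not both of them. If $r\in\{(d-1)/n,(d+1)/n\}$ is the even integer, then the rational map $\widehat\phi(z)=z\,\psi(z^n)$, with $\psi\in\mathrm{Rat}_r$ of the form given in (1) and with coefficients satisfying condition (i) if $r=(d-1)/n$, respectively (ii) if $r=(d+1)/n$, admits the antiholomorphic automorphism $\tau_n$ of order $2n$.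
   Context: $\mathrm{Rat}_d$ is the space of complex rational maps of degree $d$. Conjugation of rational maps is by Möbius transformations: $\phi$ is conjugated to $T\circ\phi\circ T^{-1}$ with $T\in\mathrm{PSL}_2(\mathbb{C})$. An extended Möbius transformation is a map $Q=T\circ J$ with $T\in\mathrm{PSL}_2(\mathbb{C})$ and $J(z)=\overline z$; it is an antiholomorphic automorphism of $\phi$ if $Q\circ\phi\circ Q^{-1}=\phi$.
   Formalization: "τ corresponds to τ_n" is taken to mean that some power τ^k with k coprime to 2n (a generator of the group of τ) is conjugated to τ_n; for τ itself the claim fails, e.g. n=4, d=9, φ(z)=z^9, τ(z)=e^{3πi/4}/z̄. *)

theory Defs
  imports
    Complex_Main
    "HOL-Computational_Algebra.Computational_Algebra"
    "HOL-Computational_Algebra.Field_as_Ring"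
begin

text \<open>
  The Riemann sphere, with \<open>None\<close> as the point at infinity (the convention of
  \<open>Alexandroff_compactification\<close> in HOL-Analysis).
\<close>

type_synonym sphere = "complex option"

definition hom_point :: "complex \<Rightarrow> complex \<Rightarrow> sphere" where
  \<comment> \<open>the point with homogeneous coordinates \<open>[u : v]\<close>; used only for \<open>(u, v) \<noteq> (0, 0)\<close>\<close>
  "hom_point u v = (if v = 0 then None else Some (u / v))"

definition rat_map :: "complex poly \<Rightarrow> complex poly \<Rightarrow> sphere \<Rightarrow> sphere" where
  \<comment> \<open>the self-map of the sphere induced by the rational function \<open>p / q\<close>, in lowest terms\<close>
  "rat_map p q x =
     (let p' = p div gcd p q; q' = q div gcd p q; m = max (degree p') (degree q') in
      case x of
        Some z \<Rightarrow> hom_point (poly p' z) (poly q' z)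
      | None \<Rightarrow> hom_point (coeff p' m) (coeff q' m))"

definition Rat :: "nat \<Rightarrow> (sphere \<Rightarrow> sphere) set" where
  "Rat d = {rat_map p q | p q. coprime p q \<and> max (degree p) (degree q) = d}"

definition moebius :: "complex \<Rightarrow> complex \<Rightarrow> complex \<Rightarrow> complex \<Rightarrow> sphere \<Rightarrow> sphere" where
  "moebius a b c d x =
     (case x of
        Some z \<Rightarrow> hom_point (a * z + b) (c * z + d)
      | None \<Rightarrow> hom_point a c)"

definition PSL2 :: "(sphere \<Rightarrow> sphere) set" where
  "PSL2 = {moebius a b c d | a b c d. a * d - b * c = 1}"

definition J :: "sphere \<Rightarrow> sphere" where
  "J = map_option cnj"

definition ext_moebius :: "(sphere \<Rightarrow> sphere) set" where
  "ext_moebius = {T \<circ> J | T. T \<in> PSL2}"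

definition antihol_aut :: "(sphere \<Rightarrow> sphere) \<Rightarrow> (sphere \<Rightarrow> sphere) \<Rightarrow> bool" where
  "antihol_aut \<phi> Q \<longleftrightarrow> Q \<in> ext_moebius \<and> Q \<circ> \<phi> \<circ> inv Q = \<phi>"

definition has_order :: "(sphere \<Rightarrow> sphere) \<Rightarrow> nat \<Rightarrow> bool" where
  "has_order f m \<longleftrightarrow> m > 0 \<and> f ^^ m = id \<and> (\<forall>k. 0 < k \<and> k < m \<longrightarrow> f ^^ k \<noteq> id)"

definition tau :: "nat \<Rightarrow> sphere \<Rightarrow> sphere" where
  "tau n x =
     (case x of
        Some z \<Rightarrow> hom_point (exp (complex_of_real pi * \<i> / of_nat n)) (cnj z)
      | None \<Rightarrow> Some 0)"

definition psi_num :: "nat \<Rightarrow> (nat \<Rightarrow> complex) \<Rightarrow> complex poly" where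
  "psi_num r a = (\<Sum>k\<le>r. monom (a k) k)"

definition psi_den :: "nat \<Rightarrow> (nat \<Rightarrow> complex) \<Rightarrow> complex poly" where
  "psi_den r a = (\<Sum>k\<le>r. monom ((-1) ^ k * cnj (a (r - k))) k)"

definition psi :: "nat \<Rightarrow> (nat \<Rightarrow> complex) \<Rightarrow> sphere \<Rightarrow> sphere" where
  "psi r a = rat_map (psi_num r a) (psi_den r a)"

definition phi_hat :: "nat \<Rightarrow> nat \<Rightarrow> (nat \<Rightarrow> complex) \<Rightarrow> sphere \<Rightarrow> sphere" where
  \<comment> \<open>\<open>z \<psi>(z\<^sup>n)\<close> formed as a rational function, so that the products \<open>0 \<cdot> \<infinity>\<close> that can occur
      at \<open>z = 0\<close> and \<open>z = \<infinity>\<close> are resolved by cancellation\<close>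
  "phi_hat n r a =
     rat_map ([:0, 1:] * pcompose (psi_num r a) (monom 1 n))
             (pcompose (psi_den r a) (monom 1 n))"

definition even_Ints :: "real set" where
  "even_Ints = real_of_int ` {k. even k}"

lemma rat_map_Some:
  assumes "poly p z \<noteq> 0 \<or> poly q z \<noteq> 0"
  shows "rat_map p q (Some z) = hom_point (poly p z) (poly q z)"
proof -
  define g where "g = gcd p q"
  have p: "p = (p div g) * g" and q: "q = (q div g) * g"
    by (simp_all add: g_def)
  have "poly p z = poly (p div g) z * poly g z" "poly q z = poly (q div g) z * poly g z"
    by (metis p poly_mult) (metis q poly_mult)
  with assms show ?thesis
    by (auto simp: rat_map_def hom_point_def Let_def simp flip: g_def)
qed

text \<open>Pointwise, \<open>phi_hat\<close> is \<open>z \<mapsto> z \<psi>(z\<^sup>n)\<close> wherever this product is unambiguous.\<close>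

lemma phi_hat_Some:
  assumes "coprime (psi_num r a) (psi_den r a)" and "z \<noteq> 0"
  shows "phi_hat n r a (Some z) = map_option ((*) z) (psi r a (Some (z ^ n)))"
proof -
  have "poly (psi_num r a) (z ^ n) \<noteq> 0 \<or> poly (psi_den r a) (z ^ n) \<noteq> 0"
    using assms(1) by (metis coprime_poly_0)
  then show ?thesis
    using assms(2) unfolding phi_hat_def psi_def
    by (subst rat_map_Some; (subst rat_map_Some)?;
        auto simp: poly_pcompose poly_monom hom_point_def)
qed

end

theory Submission
  imports Defs "HOL-Number_Theory.Cong"
begin

text \<open>
  A map of degree \<open>d\<close> is handled through a pair \<open>(p, q)\<close> of polynomials, read as binary forms
  of degree \<open>d\<close> without common zero on \<open>\<complex>\<^sup>2 \<setminus> {0}\<close>. The map determines the pair up to one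
  common scalar (\<open>represents_unique\<close>), so an identity between maps of the sphere becomes an
  identity between coefficients.

  The square of an antiholomorphic automorphism \<open>\<tau>\<close> of order \<open>2 n\<close> is a Moebius transformation
  of finite order \<open>n \<ge> 2\<close>, hence conjugate to a rotation about \<open>0\<close> and \<open>\<infinity>\<close>. Since \<open>\<tau>\<close>
  commutes with its square, it fixes or swaps these two points. Fixing them would give
  \<open>\<tau> z = a cnj z\<close>, whose square \<open>\<bar>a\<bar>\<^sup>2 z\<close> has finite order only if it is the identity. So \<open>\<tau>\<close>
  swaps them, and after a scaling \<open>\<tau> z = a / cnj z\<close> with \<open>\<bar>a\<bar> = 1\<close>
  (\<open>ext_moebius_order_normal_form\<close>). The order of \<open>\<tau>\<close> together with the parity of \<open>n\<close> makes \<open>a\<close> a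
  primitive \<open>2 n\<close>-th root of unity, so a power of \<open>\<tau>\<close> with exponent prime to \<open>2 n\<close>
  is \<open>tau n\<close> (\<open>anti_inversion_power_eq_tau\<close>). The conjugated rational map commutes with that power too.

  It remains to describe the maps commuting with \<open>z \<mapsto> \<epsilon> / cnj z\<close>, \<open>\<epsilon> = exp (\<pi> \<i> / n)\<close>.
  In coefficients this says
  \<open>p\<^sub>i \<epsilon>\<^sup>i = c \<epsilon> cnj q\<^sub>d\<^sub>-\<^sub>i\<close> and \<open>q\<^sub>i \<epsilon>\<^sup>i = c cnj p\<^sub>d\<^sub>-\<^sub>i\<close> for a constant \<open>c\<close>
  (\<open>commutes_anti_inversion_iff\<close>). Applying the reflection twice gives \<open>\<bar>c\<bar> = 1\<close>,
  \<open>2 i \<equiv> d + 1 (mod 2 n)\<close> whenever \<open>p\<^sub>i \<noteq> 0\<close>, and \<open>2 i \<equiv> d - 1 (mod 2 n)\<close> whenever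
  \<open>q\<^sub>i \<noteq> 0\<close>. This contains the invariance under the rotation \<open>tau n \<circ> tau n\<close>. As \<open>p\<close> and \<open>q\<close> are
  coprime, one of them has a nonzero constant term: either \<open>q\<^sub>0 \<noteq> 0\<close> and \<open>2 n\<close> divides
  \<open>d - 1\<close>, or \<open>p\<^sub>0 \<noteq> 0\<close> and \<open>2 n\<close> divides \<open>d + 1\<close>. In the first case \<open>(p, q)\<close>, in the second
  \<open>(z p, z q)\<close>, is \<open>(z A(z\<^sup>n), B(z\<^sup>n))\<close> with both \<open>A\<close> and \<open>B\<close> of degree at most \<open>r\<close>, and a scaling
  that absorbs \<open>c\<close> turns the reflection into the prescribed relation between \<open>A\<close> and \<open>B\<close>. The same
  coefficient criterion read backwards proves the converse part.
\<close>

section \<open>Rational maps in homogeneous coordinates\<close>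

lemma hom_point_eq_iff:
  assumes "u \<noteq> 0 \<or> v \<noteq> 0" "u' \<noteq> 0 \<or> v' \<noteq> 0"
  shows "hom_point u v = hom_point u' v' \<longleftrightarrow> u * v' = u' * v"
  using assms by (auto simp: hom_point_def field_simps)

lemma hom_point_mult: "k \<noteq> 0 \<Longrightarrow> hom_point (k * u) (k * v) = hom_point u v"
  by (auto simp: hom_point_def)

lemma hom_point_cases:
  obtains u v where "u \<noteq> 0 \<or> v \<noteq> 0" "x = hom_point u v"
proof (cases x)
  case None
  then show ?thesis using that[of 1 0] by (simp add: hom_point_def)
next
  case (Some z)
  then show ?thesis using that[of z 1] by (simp add: hom_point_def)
qed

text \<open>
  For \<open>p\<close> of degree at most \<open>d\<close>, the binary form \<open>v\<^sup>d p(u / v)\<close> extended to \<open>v = 0\<close>. It treats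
  \<open>\<infinity> = [1 : 0]\<close> like every other point, and there its value is the coefficient of index \<open>d\<close>.
\<close>

definition homog :: "nat \<Rightarrow> complex poly \<Rightarrow> complex \<Rightarrow> complex \<Rightarrow> complex" where
  "homog d p u v = (\<Sum>i\<le>d. coeff p i * u ^ i * v ^ (d - i))"

lemma homog_0 [simp]: "homog d 0 u v = 0"
  by (simp add: homog_def)

lemma homog_smult [simp]: "homog d (smult c p) u v = c * homog d p u v"
  by (simp add: homog_def sum_distrib_left mult_ac)

lemma homog_add [simp]: "homog d (p + q) u v = homog d p u v + homog d q u v"
  by (simp add: homog_def sum.distrib algebra_simps)

lemma homog_sum [simp]: "homog d (\<Sum>i\<in>I. f i) u v = (\<Sum>i\<in>I. homog d (f i) u v)"
  by (induction I rule: infinite_finite_induct) auto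

lemma homog_affine:
  assumes "degree p \<le> d"
  shows "homog d p z 1 = poly p z"
  by (subst (2) poly_as_sum_of_monoms'[OF assms, symmetric])
     (simp add: homog_def poly_sum poly_monom)

lemma homog_infinity [simp]: "homog d p u 0 = coeff p d * u ^ d"
proof -
  have "homog d p u 0 = (\<Sum>i\<le>d. if i = d then coeff p d * u ^ d else 0)"
    unfolding homog_def by (rule sum.cong) auto
  then show ?thesis by simp
qed

lemma homog_scale: "homog d p (k * u) (k * v) = k ^ d * homog d p u v"
proof -
  have "k ^ i * k ^ (d - i) = k ^ d" if "i \<le> d" for i
    using that by (simp flip: power_add)
  then show ?thesis
    unfolding homog_def sum_distrib_left power_mult_distrib
    by (intro sum.cong) (auto simp: algebra_simps)
qed

lemma homog_finite:
  assumes "degree p \<le> d" "v \<noteq> 0"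
  shows "homog d p u v = v ^ d * poly p (u / v)"
  using homog_scale[of d p v "u / v" 1] homog_affine[OF assms(1)] assms(2) by simp

text \<open>
  The absence of common zeros encodes at once that \<open>p\<close> and \<open>q\<close> are coprime (zeros with \<open>v \<noteq> 0\<close>)
  and that one of them has degree exactly \<open>d\<close> (the zero \<open>[1 : 0]\<close>).
\<close>

definition represents :: "nat \<Rightarrow> complex poly \<Rightarrow> complex poly \<Rightarrow> (sphere \<Rightarrow> sphere) \<Rightarrow> bool" where
  "represents d p q f \<longleftrightarrow> degree p \<le> d \<and> degree q \<le> d \<and>
     (\<forall>u v. u \<noteq> 0 \<or> v \<noteq> 0 \<longrightarrow>
        (homog d p u v \<noteq> 0 \<or> homog d q u v \<noteq> 0) \<and>
        f (hom_point u v) = hom_point (homog d p u v) (homog d q u v))"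

lemma coprime_if_no_common_root:
  fixes p q :: "complex poly"
  assumes "\<And>z. poly p z \<noteq> 0 \<or> poly q z \<noteq> 0"
  shows "coprime p q"
proof -
  have "degree (gcd p q) = 0"
  proof (rule ccontr)
    assume "degree (gcd p q) \<noteq> 0"
    then obtain z where "poly (gcd p q) z = 0"
      using alg_closed_imp_poly_has_root[of "gcd p q"] by auto
    then have "poly p z = 0" "poly q z = 0"
      by (meson gcd_dvd1 gcd_dvd2 dvd_trans poly_eq_0_iff_dvd)+
    with assms show False by blast
  qed
  moreover have "gcd p q \<noteq> 0"
    using assms[of 0] by auto
  ultimately have "is_unit (gcd p q)"
    by (subst is_unit_iff_degree)
  then show ?thesis by (simp only: is_unit_gcd)
qed

lemma rat_map_coprime:
  assumes "coprime p q"
  shows "rat_map p q x = (case x of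
        Some z \<Rightarrow> hom_point (poly p z) (poly q z)
      | None \<Rightarrow> hom_point (coeff p (max (degree p) (degree q))) (coeff q (max (degree p) (degree q))))"
  using assms by (simp add: rat_map_def coprime_iff_gcd_eq_1 Let_def)

lemma represents_iff:
  "represents d p q f \<longleftrightarrow> coprime p q \<and> max (degree p) (degree q) = d \<and> f = rat_map p q"
proof safe
  assume r: "represents d p q f"
  then have le: "degree p \<le> d" "degree q \<le> d"
    and nz: "\<And>u v. u \<noteq> 0 \<or> v \<noteq> 0 \<Longrightarrow> homog d p u v \<noteq> 0 \<or> homog d q u v \<noteq> 0"
    and f: "\<And>u v. u \<noteq> 0 \<or> v \<noteq> 0 \<Longrightarrow> f (hom_point u v) = hom_point (homog d p u v) (homog d q u v)"
    by (auto simp: represents_def)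
  show c: "coprime p q"
    by (rule coprime_if_no_common_root) (use nz[of _ 1] homog_affine le in auto)
  have "coeff p d \<noteq> 0 \<or> coeff q d \<noteq> 0"
    using nz[of 1 0] by simp
  then show m: "max (degree p) (degree q) = d"
    using le le_degree[of p d] le_degree[of q d] by auto
  show "f = rat_map p q"
  proof
    fix x show "f x = rat_map p q x"
    proof (cases x)
      case None
      then show ?thesis using f[of 1 0] m by (simp add: rat_map_coprime c hom_point_def[of 1 0])
    next
      case (Some z)
      then show ?thesis using f[of z 1] le
        by (simp add: rat_map_coprime c hom_point_def[of z 1] homog_affine)
    qed
  qed
next
  assume c: "coprime p q"
  let ?d = "max (degree p) (degree q)"
  have le: "degree p \<le> ?d" "degree q \<le> ?d" by auto
  have lead: "coeff p ?d \<noteq> 0 \<or> coeff q ?d \<noteq> 0"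
  proof (rule ccontr)
    assume "\<not> ?thesis"
    then have z: "coeff p ?d = 0" "coeff q ?d = 0" by auto
    have "p = 0 \<and> q = 0"
    proof (cases "degree p \<le> degree q")
      case True
      with z have "q = 0" by (simp add: max_absorb2)
      with True z show ?thesis using leading_coeff_0_iff[of p] by simp
    next
      case False
      with z have "p = 0" by (simp add: max_absorb1)
      with False show ?thesis by simp
    qed
    with c show False by simp
  qed
  show "represents ?d p q (rat_map p q)"
    unfolding represents_def
  proof (intro conjI le allI impI)
    fix u v :: complex assume uv: "u \<noteq> 0 \<or> v \<noteq> 0"
    have "(homog ?d p u v \<noteq> 0 \<or> homog ?d q u v \<noteq> 0) \<and>
       rat_map p q (hom_point u v) = hom_point (homog ?d p u v) (homog ?d q u v)"
    proof (cases "v = 0")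
      case True
      with uv lead have "u ^ ?d \<noteq> 0" by simp
      with True lead show ?thesis
        using hom_point_mult[of "u ^ ?d" "coeff p ?d" "coeff q ?d"]
        by (simp add: rat_map_coprime c hom_point_def[of u 0] mult.commute)
    next
      case False
      with coprime_poly_0[OF c, of "u / v"] show ?thesis
        by (simp add: rat_map_coprime c homog_finite hom_point_def[of u v] hom_point_mult)
    qed
    then show "homog ?d p u v \<noteq> 0 \<or> homog ?d q u v \<noteq> 0"
       "rat_map p q (hom_point u v) = hom_point (homog ?d p u v) (homog ?d q u v)" by auto
  qed
qed

lemma Rat_eq: "Rat d = {f. \<exists>p q. represents d p q f}"
  by (auto simp: Rat_def represents_iff)

text \<open>
  Equal values give \<open>p q' = p' q\<close>. With a Bezout relation \<open>x p + y q = 1\<close> the polynomial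
  \<open>c = x p' + y q'\<close> satisfies \<open>(p', q') = c (p, q)\<close>; it divides the coprime pair \<open>(p', q')\<close> and is
  therefore constant.
\<close>

lemma represents_unique:
  assumes "represents d p q f" "represents e p' q' f"
  shows "\<exists>c. c \<noteq> 0 \<and> p' = smult c p \<and> q' = smult c q"
proof -
  have cop: "coprime p q" "coprime p' q'" and f: "f = rat_map p q" "f = rat_map p' q'"
    using assms by (auto simp: represents_iff)
  have "poly (p * q') z = poly (p' * q) z" for z
  proof -
    have "hom_point (poly p z) (poly q z) = hom_point (poly p' z) (poly q' z)"
      using fun_cong[OF f(1), of "Some z"] fun_cong[OF f(2), of "Some z"]
      by (simp add: rat_map_coprime cop)
    then show ?thesis
      using coprime_poly_0[OF cop(1), of z] coprime_poly_0[OF cop(2), of z]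
      by (simp add: hom_point_eq_iff)
  qed
  then have cross: "p * q' = p' * q"
    using poly_eq_poly_eq_iff by blast
  have mult: "\<exists>c. P' = c * P \<and> Q' = c * Q"
    if PQ: "coprime P Q" "P * Q' = P' * Q" for P Q P' Q' :: "complex poly"
  proof -
    obtain x y where xy: "x * P + y * Q = 1"
      using bezout_coefficients_fst_snd[of P Q] PQ(1) unfolding coprime_iff_gcd_eq_1 by auto
    have "(x * P' + y * Q') * P = P' * (x * P + y * Q)"
         "(x * P' + y * Q') * Q = Q' * (x * P + y * Q)"
      using PQ(2) by (simp_all add: algebra_simps)
    then have "P' = (x * P' + y * Q') * P \<and> Q' = (x * P' + y * Q') * Q"
      using xy by simp
    then show ?thesis by blast
  qed
  obtain c where c: "p' = c * p" "q' = c * q" using mult[OF cop(1) cross] by blast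
  obtain c' where c': "p = c' * p'" "q = c' * q'" using mult[OF cop(2) cross[symmetric]] by blast
  have "c dvd p'" "c dvd q'" using c by auto
  then have "is_unit c"
    using cop(2) coprime_common_divisor by blast
  then have "c \<noteq> 0" by auto
  have "degree c = 0"
    using \<open>is_unit c\<close> unfolding is_unit_iff_degree[OF \<open>c \<noteq> 0\<close>] .
  then obtain k where "c = [:k:]" "k \<noteq> 0"
    using \<open>c \<noteq> 0\<close> by (auto elim: degree_eq_zeroE)
  then show ?thesis using c by auto
qed

section \<open>Moebius and extended Moebius transformations\<close>

lemma moebius_hom_point:
  assumes "u \<noteq> 0 \<or> v \<noteq> 0"
  shows "moebius a b c d (hom_point u v) = hom_point (a * u + b * v) (c * u + d * v)"
proof (cases "v = 0")
  case True
  with assms show ?thesis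
    using hom_point_mult[of u a c] by (simp add: moebius_def hom_point_def[of u 0] mult.commute)
next
  case False
  then have "hom_point (a * u + b * v) (c * u + d * v) =
      hom_point (v * (a * (u / v) + b)) (v * (c * (u / v) + d))"
    by (simp add: algebra_simps)
  also have "\<dots> = hom_point (a * (u / v) + b) (c * (u / v) + d)"
    using False by (rule hom_point_mult)
  finally show ?thesis
    using False by (simp add: moebius_def hom_point_def[of u v])
qed

lemma det_vector_nonzero:
  fixes a b c d u v :: complex
  assumes "a * d - b * c \<noteq> 0" "u \<noteq> 0 \<or> v \<noteq> 0"
  shows "a * u + b * v \<noteq> 0 \<or> c * u + d * v \<noteq> 0"
proof (rule ccontr)
  assume "\<not> ?thesis"
  then have "a * u + b * v = 0" "c * u + d * v = 0" by auto
  then have "d * (a * u + b * v) - b * (c * u + d * v) = 0"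
            "a * (c * u + d * v) - c * (a * u + b * v) = 0" by simp_all
  then have "(a * d - b * c) * u = 0" "(a * d - b * c) * v = 0"
    by (simp_all add: algebra_simps)
  with assms show False by simp
qed

lemma moebius_comp:
  assumes "a' * d' - b' * c' \<noteq> 0"
  shows "moebius a b c d \<circ> moebius a' b' c' d' =
    moebius (a * a' + b * c') (a * b' + b * d') (c * a' + d * c') (c * b' + d * d')"
proof
  fix x
  obtain u v where uv: "u \<noteq> 0 \<or> v \<noteq> 0" and x: "x = hom_point u v"
    by (rule hom_point_cases)
  show "(moebius a b c d \<circ> moebius a' b' c' d') x =
    moebius (a * a' + b * c') (a * b' + b * d') (c * a' + d * c') (c * b' + d * d') x"
    unfolding x comp_apply moebius_hom_point[OF uv]
      moebius_hom_point[OF det_vector_nonzero[OF assms uv]]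
    by (simp add: algebra_simps)
qed

lemma moebius_scale:
  assumes "k \<noteq> 0"
  shows "moebius (k * a) (k * b) (k * c) (k * d) = moebius a b c d"
proof
  fix x
  have "hom_point (k * a * z + k * b) (k * c * z + k * d) = hom_point (a * z + b) (c * z + d)" for z
    using hom_point_mult[OF assms, of "a * z + b" "c * z + d"] by (simp add: algebra_simps)
  then show "moebius (k * a) (k * b) (k * c) (k * d) x = moebius a b c d x"
    by (auto simp: moebius_def hom_point_mult assms split: option.split)
qed

text \<open>A square root of the determinant rescales any invertible matrix to determinant \<open>1\<close>.\<close>

lemma moebius_in_PSL2:
  assumes "a * d - b * c \<noteq> 0"
  shows "moebius a b c d \<in> PSL2"
proof -
  define k where "k = 1 / csqrt (a * d - b * c)"
  have k: "k \<noteq> 0" "k ^ 2 * (a * d - b * c) = 1"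
    using assms by (auto simp: k_def power_divide)
  have "(k * a) * (k * d) - (k * b) * (k * c) = 1"
    using k(2) by (simp add: algebra_simps power2_eq_square)
  then show ?thesis
    unfolding PSL2_def using moebius_scale[OF k(1), of a b c d, symmetric] by blast
qed

lemma moebius_id: "k \<noteq> 0 \<Longrightarrow> moebius k 0 0 k = id"
  by (rule ext) (auto simp: moebius_def hom_point_def split: option.split)

text \<open>
  Only the nonvanishing of the determinant is kept: then matrices may be rescaled freely, and
  \<open>moebius_in_PSL2\<close> leads back.
\<close>

lemma PSL2_cases:
  assumes "T \<in> PSL2"
  obtains a b c d where "a * d - b * c \<noteq> 0" "T = moebius a b c d"
  using assms that unfolding PSL2_def by (smt (verit, ccfv_threshold) mem_Collect_eq zero_neq_one)

lemma PSL2_comp: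
  assumes "S \<in> PSL2" "T \<in> PSL2"
  shows "S \<circ> T \<in> PSL2"
proof -
  obtain a b c d where S: "a * d - b * c \<noteq> 0" "S = moebius a b c d"
    using assms(1) by (rule PSL2_cases)
  obtain a' b' c' d' where T: "a' * d' - b' * c' \<noteq> 0" "T = moebius a' b' c' d'"
    using assms(2) by (rule PSL2_cases)
  have "(a * a' + b * c') * (c * b' + d * d') - (a * b' + b * d') * (c * a' + d * c')
      = (a * d - b * c) * (a' * d' - b' * c')"
    by (simp add: algebra_simps)
  with S T show ?thesis by (simp add: moebius_comp moebius_in_PSL2)
qed

lemma PSL2_inverse:
  assumes "T \<in> PSL2"
  shows "\<exists>S\<in>PSL2. T \<circ> S = id \<and> S \<circ> T = id"
proof -
  obtain a b c d where T: "a * d - b * c \<noteq> 0" "T = moebius a b c d"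
    using assms by (rule PSL2_cases)
  have *: "d * a - (- b) * (- c) \<noteq> 0" using T(1) by (simp add: algebra_simps)
  have "T \<circ> moebius d (- b) (- c) a = id" "moebius d (- b) (- c) a \<circ> T = id"
    using T moebius_id[of "a * d - b * c"] *
    by (simp_all add: moebius_comp algebra_simps)
  with moebius_in_PSL2[OF *] show ?thesis by blast
qed

lemma PSL2_bij: "T \<in> PSL2 \<Longrightarrow> bij T"
  using PSL2_inverse o_bij by metis

lemma PSL2_inv: "T \<in> PSL2 \<Longrightarrow> inv T \<in> PSL2"
  by (metis PSL2_inverse inv_unique_comp)

lemma J_J [simp]: "J \<circ> J = id" "J (J x) = x"
  by (auto simp: J_def fun_eq_iff option.map_comp comp_def option.map_ident)

lemma J_hom_point: "J (hom_point u v) = hom_point (cnj u) (cnj v)"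
  by (simp add: J_def hom_point_def)

lemma bij_J: "bij J"
  using J_J(1) o_bij by blast

text \<open>Conjugation by \<open>J\<close> conjugates the entries of the matrix.\<close>

lemma J_conj_PSL2:
  assumes "T \<in> PSL2"
  shows "J \<circ> T \<circ> J \<in> PSL2"
proof -
  obtain a b c d where T: "a * d - b * c \<noteq> 0" "T = moebius a b c d"
    using assms by (rule PSL2_cases)
  have *: "cnj a * cnj d - cnj b * cnj c \<noteq> 0"
    using T(1) by (metis complex_cnj_diff complex_cnj_mult complex_cnj_zero_iff)
  have "J \<circ> T \<circ> J = moebius (cnj a) (cnj b) (cnj c) (cnj d)"
  proof
    fix x
    obtain u v where uv: "u \<noteq> 0 \<or> v \<noteq> 0" and x: "x = hom_point u v"
      by (rule hom_point_cases)
    then show "(J \<circ> T \<circ> J) x = moebius (cnj a) (cnj b) (cnj c) (cnj d) x"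
      by (simp add: T(2) J_hom_point moebius_hom_point)
  qed
  with moebius_in_PSL2[OF *] show ?thesis by simp
qed

lemma ext_moebius_iff: "Q \<in> ext_moebius \<longleftrightarrow> Q \<circ> J \<in> PSL2"
  unfolding ext_moebius_def
  by (auto simp: comp_assoc intro: exI[of _ "Q \<circ> J"])

lemma ext_moebius_bij: "Q \<in> ext_moebius \<Longrightarrow> bij Q"
  unfolding ext_moebius_def using PSL2_bij bij_J by (auto intro: bij_comp)

lemma ext_moebius_conj:
  assumes "T \<in> PSL2" "Q \<in> ext_moebius"
  shows "T \<circ> Q \<circ> inv T \<in> ext_moebius"
proof -
  have "T \<circ> Q \<circ> inv T \<circ> J = (T \<circ> (Q \<circ> J)) \<circ> (J \<circ> inv T \<circ> J)"
    by (simp add: fun_eq_iff)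
  then show ?thesis
    using assms by (simp add: ext_moebius_iff PSL2_comp J_conj_PSL2 PSL2_inv)
qed

lemma ext_moebius_square:
  assumes "Q \<in> ext_moebius"
  shows "Q \<circ> Q \<in> PSL2"
proof -
  have "Q \<circ> Q = (Q \<circ> J) \<circ> (J \<circ> (Q \<circ> J) \<circ> J)"
    by (simp add: fun_eq_iff)
  then show ?thesis
    using assms by (simp only: ext_moebius_iff PSL2_comp J_conj_PSL2)
qed

lemma conj_funpow:
  assumes "bij T"
  shows "(T \<circ> f \<circ> inv T) ^^ k = T \<circ> f ^^ k \<circ> inv T"
proof (induction k)
  case 0
  show ?case using assms by (auto simp: fun_eq_iff bij_is_surj surj_f_inv_f)
next
  case (Suc k)
  then show ?case using assms by (auto simp: fun_eq_iff bij_is_inj)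
qed

lemma conj_eq_id_iff:
  assumes "bij T"
  shows "T \<circ> f \<circ> inv T = id \<longleftrightarrow> f = id"
proof
  assume "T \<circ> f \<circ> inv T = id"
  then have "inv T (T (f (inv T (T x)))) = inv T (T x)" for x
    by (simp add: fun_eq_iff)
  then show "f = id" using assms by (simp add: fun_eq_iff bij_is_inj)
qed (use assms in \<open>auto simp: fun_eq_iff bij_is_surj surj_f_inv_f\<close>)

lemma has_order_conj:
  assumes "bij T"
  shows "has_order (T \<circ> f \<circ> inv T) m \<longleftrightarrow> has_order f m"
  by (simp only: has_order_def conj_funpow conj_eq_id_iff assms)

lemma conj_conj:
  assumes "bij S" "bij T"
  shows "S \<circ> (T \<circ> f \<circ> inv T) \<circ> inv S = (S \<circ> T) \<circ> f \<circ> inv (S \<circ> T)"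
  using assms by (simp add: o_inv_distrib comp_assoc)

section \<open>The maps with formula a / cnj z\<close>

definition anti_inversion :: "complex \<Rightarrow> sphere \<Rightarrow> sphere" where
  "anti_inversion a x = (case x of Some z \<Rightarrow> hom_point a (cnj z) | None \<Rightarrow> Some 0)"

lemma tau_eq_anti_inversion: "tau n = anti_inversion (exp (complex_of_real pi * \<i> / of_nat n))"
  by (simp add: fun_eq_iff tau_def anti_inversion_def)

lemma anti_inversion_hom_point:
  assumes "a \<noteq> 0" "u \<noteq> 0 \<or> v \<noteq> 0"
  shows "anti_inversion a (hom_point u v) = hom_point (a * cnj v) (cnj u)"
  using assms by (auto simp: anti_inversion_def hom_point_def field_simps)

lemma anti_inversion_eq:
  assumes "a \<noteq> 0"
  shows "anti_inversion a = moebius 0 a 1 0 \<circ> J"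
proof
  fix x
  obtain u v where uv: "u \<noteq> 0 \<or> v \<noteq> 0" and x: "x = hom_point u v"
    by (rule hom_point_cases)
  then show "anti_inversion a x = (moebius 0 a 1 0 \<circ> J) x"
    using assms by (simp add: anti_inversion_hom_point moebius_hom_point J_hom_point)
qed

lemma anti_inversion_ext_moebius: "a \<noteq> 0 \<Longrightarrow> anti_inversion a \<in> ext_moebius"
  unfolding ext_moebius_def using moebius_in_PSL2[of 0 0 a 1] by (auto simp: anti_inversion_eq)

lemma cnj_unit:
  assumes "norm b = 1"
  shows "cnj b = 1 / b"
proof -
  have "b * cnj b = 1" using assms by (simp flip: complex_norm_square)
  moreover from this have "b \<noteq> 0" by auto
  ultimately show ?thesis by (simp add: field_simps)
qed

text \<open>
  On the unit circle \<open>1 / cnj a = a\<close>. Hence each application of the map multiplies the parameter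
  by \<open>a\<close> and alternates between rotations and maps of the same kind.
\<close>

lemma anti_inversion_funpow:
  assumes "norm a = 1"
  shows "anti_inversion a ^^ (2 * j) = map_option ((*) (a ^ (2 * j)))"
    and "anti_inversion a ^^ (2 * j + 1) = anti_inversion (a ^ (2 * j + 1))"
proof -
  have a0: "a \<noteq> 0" using assms by auto
  have step: "anti_inversion a \<circ> anti_inversion b = map_option ((*) (a * b))"
     if "norm b = 1" for b
  proof
    fix x
    have b0: "b \<noteq> 0" using that by auto
    show "(anti_inversion a \<circ> anti_inversion b) x = map_option ((*) (a * b)) x"
      using a0 b0 by (cases x) (auto simp: anti_inversion_def hom_point_def cnj_unit that)
  qed
  have step': "anti_inversion a \<circ> map_option ((*) b) = anti_inversion (a * b)"
     if "norm b = 1" for b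
  proof
    fix x
    have b0: "b \<noteq> 0" using that by auto
    show "(anti_inversion a \<circ> map_option ((*) b)) x = anti_inversion (a * b) x"
      using a0 b0 by (cases x) (auto simp: anti_inversion_def hom_point_def cnj_unit that)
  qed
  have E: "anti_inversion a ^^ (2 * j) = map_option ((*) (a ^ (2 * j)))" for j
  proof (induction j)
    case 0
    show ?case by (auto simp: fun_eq_iff option.map_ident)
  next
    case (Suc j)
    have "anti_inversion a ^^ (2 * Suc j) = anti_inversion a \<circ> (anti_inversion a \<circ> anti_inversion a ^^ (2 * j))"
      by simp
    also have "\<dots> = map_option ((*) (a * (a * a ^ (2 * j))))"
      unfolding Suc using assms by (subst step', simp add: norm_power, subst step) (simp_all add: norm_mult norm_power)
    finally show ?case by simp
  qed
  show "anti_inversion a ^^ (2 * j) = map_option ((*) (a ^ (2 * j)))" by (rule E)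
  have "anti_inversion a ^^ (2 * j + 1) = anti_inversion a \<circ> anti_inversion a ^^ (2 * j)"
    by simp
  then show "anti_inversion a ^^ (2 * j + 1) = anti_inversion (a ^ (2 * j + 1))"
    unfolding E using assms by (subst (asm) step') (simp_all add: norm_power)
qed

section \<open>Normal form of antiholomorphic automorphisms of finite order\<close>

lemma PSL2_fixes_infinity:
  assumes "T \<in> PSL2" "T None = None"
  obtains \<alpha> \<beta> where "\<alpha> \<noteq> 0" "T = map_option (\<lambda>z. \<alpha> * z + \<beta>)"
proof -
  obtain a b c d where T: "a * d - b * c \<noteq> 0" "T = moebius a b c d"
    using assms(1) by (rule PSL2_cases)
  have "c = 0" using assms(2) T(2) by (auto simp: moebius_def hom_point_def split: if_splits)
  with T have "a / d \<noteq> 0" "T = map_option (\<lambda>z. a / d * z + b / d)"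
    by (auto simp: moebius_def hom_point_def fun_eq_iff add_divide_distrib split: option.split)
  then show ?thesis by (rule that)
qed

lemma affine_in_PSL2:
  assumes "\<alpha> \<noteq> 0"
  shows "map_option (\<lambda>z. \<alpha> * z + \<beta>) \<in> PSL2"
proof -
  have "map_option (\<lambda>z. \<alpha> * z + \<beta>) = moebius \<alpha> \<beta> 0 1"
    by (auto simp: moebius_def hom_point_def fun_eq_iff split: option.split)
  with assms moebius_in_PSL2[of \<alpha> 1 \<beta> 0] show ?thesis by simp
qed

text \<open>
  If \<open>\<infinity>\<close> is moved, then \<open>c \<noteq> 0\<close> and the fixed points are the roots of the quadratic polynomial
  \<open>c z\<^sup>2 + (d - a) z - b\<close>.
\<close>

lemma PSL2_has_fixed_point:
  assumes "T \<in> PSL2"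
  shows "\<exists>x. T x = x"
proof -
  obtain a b c d where T: "a * d - b * c \<noteq> 0" "T = moebius a b c d"
    using assms by (rule PSL2_cases)
  show ?thesis
  proof (cases "c = 0")
    case True
    then have "T None = None" by (simp add: T moebius_def hom_point_def)
    then show ?thesis by blast
  next
    case False
    then obtain z where "poly [:- b, d - a, c:] z = 0"
      using alg_closed_imp_poly_has_root[of "[:- b, d - a, c:]"] by auto
    then have z: "a * z + b = z * (c * z + d)"
      by (simp add: algebra_simps)
    have "c * z + d \<noteq> 0"
      using det_vector_nonzero[OF T(1), of z 1] z by auto
    then have "T (Some z) = Some z"
      by (simp add: T moebius_def hom_point_def z)
    then show ?thesis by blast
  qed
qed

lemma PSL2_moves_to_infinity: "\<exists>T\<in>PSL2. T x = None"
proof (cases x)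
  case None
  then show ?thesis using moebius_in_PSL2[of 1 1 0 0] moebius_id[of 1] by (auto intro!: bexI[of _ id])
next
  case (Some p)
  then have "moebius 0 (-1) 1 (- p) x = None"
    by (simp add: moebius_def hom_point_def)
  with moebius_in_PSL2[of 0 "- p" "- 1" 1] show ?thesis by auto
qed

text \<open>
  With one fixed point moved to \<open>\<infinity>\<close>, the map is \<open>z \<mapsto> \<alpha> z + \<beta>\<close>. A translation of finite order is
  the identity, so \<open>\<alpha> \<noteq> 1\<close>, and the second fixed point \<open>\<beta> / (1 - \<alpha>)\<close> can be moved to \<open>0\<close>.
\<close>

lemma finite_order_moebius_fixed_points:
  assumes "M \<in> PSL2" "M ^^ n = id" "n > 0" "M \<noteq> id"
  obtains T \<alpha> where "T \<in> PSL2" "\<alpha> \<noteq> 1" "T \<circ> M \<circ> inv T = map_option ((*) \<alpha>)"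
proof -
  obtain x where x: "M x = x" using PSL2_has_fixed_point assms(1) by blast
  obtain S where S: "S \<in> PSL2" "S x = None" using PSL2_moves_to_infinity by blast
  note bS = PSL2_bij[OF S(1)]
  let ?M = "S \<circ> M \<circ> inv S"
  have "?M None = None"
    using x S(2) bS by (metis bij_inv_eq_iff comp_apply)
  moreover have "?M \<in> PSL2"
    using assms(1) S(1) by (intro PSL2_comp PSL2_inv)
  ultimately obtain \<alpha> \<beta> where M: "?M = map_option (\<lambda>z. \<alpha> * z + \<beta>)"
    using PSL2_fixes_infinity by metis
  have order: "?M ^^ n = id" "?M \<noteq> id"
    using assms by (simp_all only: conj_funpow conj_eq_id_iff bS not_False_eq_True)
  have \<alpha>: "\<alpha> \<noteq> 1"
  proof
    assume "\<alpha> = 1"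
    have "(?M ^^ k) (Some 0) = Some (of_nat k * \<beta>)" for k
      unfolding M \<open>\<alpha> = 1\<close> by (induction k) (simp_all add: algebra_simps)
    with order(1) have "of_nat n * \<beta> = 0" by (metis id_apply option.inject)
    with assms(3) have "\<beta> = 0" by simp
    with M \<open>\<alpha> = 1\<close> order(2) show False by (auto simp: option.map_ident fun_eq_iff)
  qed
  define z0 where "z0 = \<beta> / (1 - \<alpha>)"
  define R where "R = map_option (\<lambda>z. 1 * z + (- z0))"
  have R: "R \<in> PSL2" unfolding R_def by (rule affine_in_PSL2) simp
  have "inv R = map_option (\<lambda>z. z + z0)"
    by (rule inv_unique_comp) (auto simp: R_def fun_eq_iff option.map_comp comp_def option.map_ident)
  moreover have "\<alpha> * z0 + \<beta> = z0"
    using \<alpha> by (simp add: z0_def field_simps)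
  then have "\<alpha> * (z + z0) + \<beta> - z0 = \<alpha> * z" for z
    by (simp add: algebra_simps)
  ultimately have "R \<circ> ?M \<circ> inv R = map_option ((*) \<alpha>)"
    unfolding M by (simp add: R_def fun_eq_iff option.map_comp comp_def)
  then have "(R \<circ> S) \<circ> M \<circ> inv (R \<circ> S) = map_option ((*) \<alpha>)"
    by (simp only: conj_conj[OF PSL2_bij[OF R] bS])
  with \<alpha> PSL2_comp[OF R S(1)] show ?thesis by (intro that)
qed

lemma map_option_mult_eq_id_iff: "map_option ((*) a) = id \<longleftrightarrow> a = (1 :: complex)"
proof
  assume "map_option ((*) a) = id"
  then have "map_option ((*) a) (Some 1) = Some 1" by simp
  then show "a = 1" by simp
next
  assume "a = 1"
  then have "((*) a) = id" by auto
  then show "map_option ((*) a) = id" by (simp only: option.map_id0)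
qed

lemma square_funpow: "(f \<circ> f) ^^ n = f ^^ (2 * n)"
  by (induction n) (auto simp: fun_eq_iff)

lemma map_option_mult_funpow: "map_option ((*) a) ^^ k = map_option ((*) (a ^ k :: complex))"
  by (induction k) (auto simp: fun_eq_iff option.map_ident option.map_comp comp_def mult.assoc)

text \<open>
  The transformation commutes with its square, whose fixed points are put at \<open>0\<close> and \<open>\<infinity>\<close>.
  Fixing both is excluded by finite order, since the multiplier of the square would be a positive
  real root of unity; so they are swapped, and the modulus of the remaining parameter is
  normalized by a real scaling.
\<close>

lemma ext_moebius_order_normal_form:
  assumes "\<tau> \<in> ext_moebius" "has_order \<tau> (2 * n)" "n \<ge> 2"
  obtains T a where "T \<in> PSL2" "norm a = 1" "T \<circ> \<tau> \<circ> inv T = anti_inversion a"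
proof -
  have "(\<tau> \<circ> \<tau>) ^^ n = id"
    using assms(2) by (simp add: has_order_def square_funpow)
  moreover have "\<tau> ^^ 2 \<noteq> id"
    using assms(2,3) unfolding has_order_def by auto
  then have "\<tau> \<circ> \<tau> \<noteq> id" by (simp add: numeral_2_eq_2)
  ultimately obtain T \<alpha> where T: "T \<in> PSL2" "\<alpha> \<noteq> 1" "T \<circ> (\<tau> \<circ> \<tau>) \<circ> inv T = map_option ((*) \<alpha>)"
    using finite_order_moebius_fixed_points[OF ext_moebius_square[OF assms(1)], of n] assms(3)
    by auto
  note bT = PSL2_bij[OF T(1)]
  define \<sigma> where "\<sigma> = T \<circ> \<tau> \<circ> inv T"
  have \<sigma>: "\<sigma> \<in> ext_moebius" "has_order \<sigma> (2 * n)"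
    unfolding \<sigma>_def using assms T(1) bT by (simp_all only: ext_moebius_conj has_order_conj)
  have sq: "\<sigma> \<circ> \<sigma> = map_option ((*) \<alpha>)"
    unfolding T(3)[symmetric] \<sigma>_def using bT by (simp add: fun_eq_iff bij_is_inj)
  then have sq': "\<sigma> (\<sigma> x) = map_option ((*) \<alpha>) x" for x by (metis comp_apply)
  have fixed: "x = None \<or> x = Some 0" if "map_option ((*) \<alpha>) x = x" for x
    using that T(2) by (cases x) auto
  have \<alpha>n: "\<alpha> ^ n = 1"
  proof -
    have "\<sigma> ^^ (2 * n) = (\<sigma> \<circ> \<sigma>) ^^ n"
      by (simp add: square_funpow)
    then show ?thesis using \<sigma>(2)
      by (simp add: has_order_def sq map_option_mult_funpow map_option_mult_eq_id_iff)
  qed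
  have perm: "\<sigma> x \<in> {None, Some 0}" if "x \<in> {None, Some 0}" for x
  proof -
    have "map_option ((*) \<alpha>) (\<sigma> x) = \<sigma> (map_option ((*) \<alpha>) x)"
      by (simp flip: sq')
    then show ?thesis using that fixed[of "\<sigma> x"] by auto
  qed
  have inj: "inj \<sigma>" using ext_moebius_bij[OF \<sigma>(1)] by (rule bij_is_inj)
  have SJ: "\<sigma> \<circ> J \<in> PSL2" using \<sigma>(1) by (simp add: ext_moebius_iff)
  have swap: "\<sigma> None = Some 0"
  proof (rule ccontr)
    assume "\<sigma> None \<noteq> Some 0"
    then have 1: "\<sigma> None = None" using perm by auto
    then have 2: "\<sigma> (Some 0) = Some 0"
      using perm[of "Some 0"] inj_eq[OF inj, of "Some 0" None] by auto
    have "(\<sigma> \<circ> J) None = None" using 1 by (simp add: J_def)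
    with SJ obtain a b where ab: "\<sigma> \<circ> J = map_option (\<lambda>z. a * z + b)"
      using PSL2_fixes_infinity by metis
    have "(\<sigma> \<circ> J) (Some 0) = Some 0" using 2 by (simp add: J_def)
    with ab have "b = 0" by simp
    have "\<sigma> (Some z) = Some (a * cnj z)" for z
      using fun_cong[OF ab, of "Some (cnj z)"] \<open>b = 0\<close> by (simp add: J_def)
    then have "\<alpha> = a * cnj a"
      using sq'[of "Some 1"] by simp
    then have \<alpha>: "\<alpha> = of_real (norm a ^ 2)" by (simp only: complex_norm_square)
    then have "norm \<alpha> = norm a ^ 2" by (simp add: norm_power)
    moreover have "norm \<alpha> ^ n = 1"
      using \<alpha>n by (simp flip: norm_power)
    then have "norm \<alpha> = 1"
      using assms(3) power_eq_imp_eq_base[of "norm \<alpha>" n 1] by simp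
    ultimately show False using \<alpha> T(2) by simp
  qed
  have swap': "\<sigma> (Some 0) = None"
    using perm[of "Some 0"] swap inj_eq[OF inj, of "Some 0" None] by auto
  obtain a where a: "a \<noteq> 0" "\<sigma> = anti_inversion a"
  proof -
    obtain a b c d where m: "a * d - b * c \<noteq> 0" "\<sigma> \<circ> J = moebius a b c d"
      using SJ by (rule PSL2_cases)
    have "hom_point a c = Some 0"
      using swap fun_cong[OF m(2), of None] by (simp add: J_def moebius_def)
    moreover have "hom_point b d = None"
      using swap' fun_cong[OF m(2), of "Some 0"] by (simp add: J_def moebius_def)
    ultimately have z: "a = 0" "d = 0"
      by (auto simp: hom_point_def split: if_splits)
    with m(1) have bc: "b \<noteq> 0" "c \<noteq> 0" by auto
    have "\<sigma> \<circ> J = moebius 0 (b / c) 1 0"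
      using moebius_scale[of c 0 "b / c" 1 0] m(2) z bc by simp
    moreover have "\<sigma> = (\<sigma> \<circ> J) \<circ> J" by (simp add: comp_assoc)
    ultimately have "\<sigma> = anti_inversion (b / c)"
      using bc by (simp add: anti_inversion_eq)
    with bc show ?thesis by (intro that[of "b / c"]) simp_all
  qed
  \<comment> \<open>conjugation by \<open>z \<mapsto> s z\<close> multiplies the parameter \<open>a\<close> by \<open>\<bar>s\<bar>\<^sup>2\<close>\<close>
  define s where "s = 1 / sqrt (norm a)"
  have s: "s > 0" "s ^ 2 * norm a = 1"
    using a(1) by (simp_all add: s_def power_divide)
  define R :: "sphere \<Rightarrow> sphere" where "R = map_option (\<lambda>z. of_real s * z + 0)"
  have R: "R \<in> PSL2" unfolding R_def using s(1) by (intro affine_in_PSL2) simp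
  have invR: "inv R = map_option (\<lambda>z. z / of_real s)"
    using s(1) by (intro inv_unique_comp) (auto simp: R_def fun_eq_iff option.map_comp comp_def option.map_ident)
  have "R \<circ> \<sigma> \<circ> inv R = anti_inversion (of_real (s ^ 2) * a)"
  proof
    fix x show "(R \<circ> \<sigma> \<circ> inv R) x = anti_inversion (of_real (s ^ 2) * a) x"
      unfolding comp_apply invR a(2) unfolding R_def using s(1)
      by (cases x) (auto simp: anti_inversion_def hom_point_def power2_eq_square)
  qed
  then have "(R \<circ> T) \<circ> \<tau> \<circ> inv (R \<circ> T) = anti_inversion (of_real (s ^ 2) * a)"
    unfolding \<sigma>_def by (simp only: conj_conj[OF PSL2_bij[OF R] bT])
  moreover have "norm (of_real (s ^ 2) * a) = 1"
    using s by (simp add: norm_mult norm_power)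
  ultimately show ?thesis using PSL2_comp[OF R T(1)] that by blast
qed

text \<open>The coefficient of \<open>tau n\<close> is a primitive root of unity of order \<open>2 n\<close>.\<close>

lemma primitive_2n_root_powers:
  assumes "n > 0"
  defines "\<epsilon> \<equiv> exp (complex_of_real pi * \<i> / of_nat n)"
  shows "norm \<epsilon> = 1" "\<epsilon> ^ n = -1" "\<epsilon> ^ i = \<epsilon> ^ j \<longleftrightarrow> [i = j] (mod 2 * n)"
proof -
  have \<epsilon>: "\<epsilon> = cis (2 * pi / real (2 * n))"
    by (simp add: \<epsilon>_def cis_conv_exp mult_ac)
  show "norm \<epsilon> = 1" by (simp add: \<epsilon>)
  show mn: "\<epsilon> ^ n = -1" using assms(1) by (simp add: \<epsilon> DeMoivre)
  have one: "\<epsilon> ^ (2 * n) = 1" by (simp add: mn power_mult mult.commute[of 2])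
  have inj: "inj_on (\<lambda>k. \<epsilon> ^ k) {..<2 * n}"
    using bij_betw_roots_unity[of "2 * n"] assms(1) by (simp add: \<epsilon> DeMoivre mult_ac bij_betw_def)
  have red: "\<epsilon> ^ k = \<epsilon> ^ (k mod (2 * n))" for k
    by (metis one div_mult_mod_eq mult.commute mult_1 power_add power_mult power_one)
  show "\<epsilon> ^ i = \<epsilon> ^ j \<longleftrightarrow> [i = j] (mod 2 * n)"
    using inj_onD[OF inj, of "i mod (2 * n)" "j mod (2 * n)"] assms(1)
    by (auto simp: cong_def red[of i] red[of j] simp del: mult_Suc)
qed

text \<open>
  Write \<open>a = \<epsilon>\<^sup>m\<close> with \<open>\<epsilon> = exp (\<pi> \<i> / n)\<close>. If \<open>m\<close> and \<open>n\<close> had a common factor \<open>g > 1\<close>, the even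
  power \<open>2 n / g\<close> of the map would already be the identity. So \<open>m\<close> is prime to \<open>n\<close>; as \<open>n\<close> is even,
  \<open>m\<close> is odd and prime to \<open>2 n\<close>, and \<open>k\<close> is the inverse of \<open>m\<close> modulo \<open>2 n\<close>.
\<close>

lemma anti_inversion_power_eq_tau:
  fixes a :: complex
  assumes "norm a = 1" "has_order (anti_inversion a) (2 * n)" "n > 0" "even n"
  obtains k where "coprime k (2 * n)" "anti_inversion a ^^ k = tau n"
proof -
  define \<epsilon> where "\<epsilon> = exp (complex_of_real pi * \<i> / of_nat n)"
  have \<epsilon>: "\<epsilon> = cis (2 * pi / real (2 * n))"
    by (simp add: \<epsilon>_def cis_conv_exp mult_ac)
  have \<epsilon>2n: "\<epsilon> ^ (2 * n) = 1"
    using primitive_2n_root_powers(3)[OF assms(3), of "2 * n" 0] by (simp add: \<epsilon>_def cong_def)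
  have pow: "(map_option ((*) (a ^ (2 * j))) :: sphere \<Rightarrow> sphere) = anti_inversion a ^^ (2 * j)" for j
    using anti_inversion_funpow[OF assms(1)] by simp
  have "a ^ (2 * n) = 1"
    using assms(2) pow[of n] unfolding has_order_def by (simp add: map_option_mult_eq_id_iff)
  then have "a \<in> (\<lambda>k. cis (2 * pi * real k / real (2 * n))) ` {..<2 * n}"
    using bij_betw_roots_unity[of "2 * n"] assms(3) by (auto simp: bij_betw_def)
  then obtain m where m: "a = \<epsilon> ^ m"
    by (auto simp: \<epsilon> DeMoivre mult_ac)
  have "gcd m n = 1"
  proof (rule ccontr)
    assume g: "gcd m n \<noteq> 1"
    obtain m' n' where mn: "m = gcd m n * m'" "n = gcd m n * n'"
      by (metis dvdE gcd_dvd1 gcd_dvd2)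
    with assms(3) have n': "0 < n'" by (cases n') auto
    have "gcd m n \<noteq> 0" using assms(3) by simp
    with g have "gcd m n > 1" by linarith
    with n' have "n' < n" using n_less_m_mult_n[of n' "gcd m n"] mn(2) by simp
    have "m * n' = n * m'"
      using mn by (metis mult.assoc mult.commute)
    then have "m * (2 * n') = (2 * n) * m'" by simp
    then have "a ^ (2 * n') = \<epsilon> ^ ((2 * n) * m')"
      unfolding m by (simp only: power_mult[symmetric])
    also have "\<dots> = (\<epsilon> ^ (2 * n)) ^ m'" by (rule power_mult)
    also have "\<dots> = 1" by (simp only: \<epsilon>2n power_one)
    finally have "anti_inversion a ^^ (2 * n') = id"
      using pow[of n'] map_option_mult_eq_id_iff by metis
    with assms(2) n' \<open>n' < n\<close> show False
      unfolding has_order_def by (auto dest!: spec[of _ "2 * n'"])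
  qed
  then have "coprime m n" by (simp add: coprime_iff_gcd_eq_1)
  moreover have "coprime m 2"
    using \<open>coprime m n\<close> assms(4) by (meson coprime_divisors dvd_refl)
  ultimately have "coprime m (2 * n)" by simp
  then obtain k where k: "[m * k = 1] (mod 2 * n)"
    using cong_solve_coprime_nat One_nat_def by metis
  then have cop: "coprime k (2 * n)"
    by (metis coprime_iff_invertible_nat mult.commute One_nat_def)
  then have "odd k" by auto
  then obtain j where j: "k = 2 * j + 1" by (elim oddE)
  have "a ^ k = \<epsilon> ^ (m * k)" by (simp add: m power_mult)
  also have "\<dots> = \<epsilon> ^ ((m * k) mod (2 * n))"
    by (metis \<epsilon>2n div_mult_mod_eq mult.commute mult_1 power_add power_mult power_one)
  also have "(m * k) mod (2 * n) = 1"
    using k assms(3) by (simp add: cong_def)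
  finally have "anti_inversion a ^^ k = tau n"
    using anti_inversion_funpow(2)[OF assms(1), of j] j by (simp add: tau_eq_anti_inversion \<epsilon>_def)
  with cop show ?thesis by (rule that)
qed

text \<open>
  Odd powers move \<open>\<infinity>\<close> to \<open>0\<close>; an even power \<open>k\<close> is the rotation by \<open>\<epsilon>\<^sup>k\<close>, where
  \<open>\<epsilon> = exp (\<pi> \<i> / n)\<close>.
\<close>

lemma tau_has_order:
  assumes "n > 0"
  shows "has_order (tau n) (2 * n)"
proof -
  define \<epsilon> where "\<epsilon> = exp (complex_of_real pi * \<i> / of_nat n)"
  note \<epsilon> = primitive_2n_root_powers[OF assms, folded \<epsilon>_def]
  note pow = anti_inversion_funpow[OF \<epsilon>(1)]
  have "\<epsilon> ^ (2 * n) = 1"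
    using \<epsilon>(3)[of "2 * n" 0] by (simp add: cong_def)
  then have "anti_inversion \<epsilon> ^^ (2 * n) = id"
    by (simp add: pow map_option_mult_eq_id_iff)
  moreover have "anti_inversion \<epsilon> ^^ k \<noteq> id" if k: "0 < k" "k < 2 * n" for k
  proof (cases "even k")
    case True
    then obtain j where j: "k = 2 * j" by blast
    have "\<epsilon> ^ k \<noteq> \<epsilon> ^ 0"
      using k by (simp only: \<epsilon>(3)) (simp add: cong_def)
    then show ?thesis by (simp only: j pow map_option_mult_eq_id_iff) simp
  next
    case False
    then obtain j where j: "k = 2 * j + 1" by (elim oddE)
    have "(anti_inversion \<epsilon> ^^ k) None \<noteq> None"
      unfolding j pow by (simp add: anti_inversion_def)
    then show ?thesis by auto
  qed
  ultimately show ?thesis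
    using assms by (simp add: has_order_def tau_eq_anti_inversion \<epsilon>_def)
qed

section \<open>Conjugation by Moebius transformations preserves the degree\<close>

lemma represents_post_moebius:
  assumes "represents m p q f" "a * d - b * c \<noteq> 0"
  shows "represents m (smult a p + smult b q) (smult c p + smult d q) (moebius a b c d \<circ> f)"
  unfolding represents_def
proof (intro conjI allI impI)
  show "degree (smult a p + smult b q) \<le> m" "degree (smult c p + smult d q) \<le> m"
    using assms(1) by (auto simp: represents_def intro!: degree_add_le order.trans[OF degree_smult_le])
  fix u v :: complex assume uv: "u \<noteq> 0 \<or> v \<noteq> 0"
  with assms(1) have f: "homog m p u v \<noteq> 0 \<or> homog m q u v \<noteq> 0"
     "f (hom_point u v) = hom_point (homog m p u v) (homog m q u v)"
    unfolding represents_def by blast+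
  then show "(moebius a b c d \<circ> f) (hom_point u v) =
      hom_point (homog m (smult a p + smult b q) u v) (homog m (smult c p + smult d q) u v)"
    by (simp add: moebius_hom_point)
  show "homog m (smult a p + smult b q) u v \<noteq> 0 \<or> homog m (smult c p + smult d q) u v \<noteq> 0"
    using det_vector_nonzero[OF assms(2) f(1)] by simp
qed

lemma homog_Suc:
  assumes "degree p \<le> d"
  shows "homog (Suc d) p u v = v * homog d p u v"
  using assms by (simp add: homog_def sum_distrib_left coeff_eq_0 Suc_diff_le mult_ac)

lemma homog_pCons_0: "homog (Suc d) (pCons 0 p) u v = u * homog d p u v"
  unfolding homog_def by (subst sum.atMost_Suc_shift) (simp add: sum_distrib_left mult_ac)

lemma homog_linear_mult:
  assumes "degree p \<le> d"
  shows "homog (Suc d) ([:\<beta>, \<alpha>:] * p) u v = (\<alpha> * u + \<beta> * v) * homog d p u v"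
  using assms by (simp add: homog_Suc homog_pCons_0 algebra_simps)

lemma degree_linear_powers: "degree ([:\<beta>, \<alpha>:] ^ i * [:\<delta>, \<gamma>:] ^ j) \<le> i + j"
proof -
  have "degree ([:b, a:] ^ k) \<le> k" for b a :: 'a and k
    using degree_power_le[of "[:b, a:]" k] by (auto split: if_splits)
  then show ?thesis
    by (meson add_mono degree_mult_le order.trans)
qed

lemma homog_linear_powers:
  "homog (i + j) ([:\<beta>, \<alpha>:] ^ i * [:\<delta>, \<gamma>:] ^ j) u v = (\<alpha> * u + \<beta> * v) ^ i * (\<gamma> * u + \<delta> * v) ^ j"
proof (induction i)
  case 0
  show ?case
  proof (induction j)
    case (Suc j)
    then show ?case
      using homog_linear_mult[OF degree_linear_powers[of 0 0 0 \<delta> \<gamma> j]] by simp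
  qed (simp add: homog_def)
next
  case (Suc i)
  then show ?case
    using homog_linear_mult[OF degree_linear_powers[of \<beta> \<alpha> i \<delta> \<gamma> j]]
    by (simp only: add_Suc power_Suc mult.assoc)
qed

text \<open>
  The binary form of degree \<open>m\<close> of \<open>p\<close> after the linear substitution
  \<open>(u, v) \<mapsto> (\<alpha> u + \<beta> v, \<gamma> u + \<delta> v)\<close>, dehomogenized at \<open>v = 1\<close>.
\<close>

definition linear_subst ::
  "nat \<Rightarrow> complex poly \<Rightarrow> complex \<Rightarrow> complex \<Rightarrow> complex \<Rightarrow> complex \<Rightarrow> complex poly" where
  "linear_subst m p \<alpha> \<beta> \<gamma> \<delta> =
     (\<Sum>i\<le>m. smult (coeff p i) ([:\<beta>, \<alpha>:] ^ i * [:\<delta>, \<gamma>:] ^ (m - i)))"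

lemma homog_linear_subst:
  "homog m (linear_subst m p \<alpha> \<beta> \<gamma> \<delta>) u v = homog m p (\<alpha> * u + \<beta> * v) (\<gamma> * u + \<delta> * v)"
proof -
  have "homog m ([:\<beta>, \<alpha>:] ^ i * [:\<delta>, \<gamma>:] ^ (m - i)) u v
      = (\<alpha> * u + \<beta> * v) ^ i * (\<gamma> * u + \<delta> * v) ^ (m - i)" if "i \<le> m" for i
    using homog_linear_powers[of i "m - i"] that by simp
  then show ?thesis
    by (simp add: linear_subst_def homog_def[of m p] mult.assoc)
qed

lemma degree_linear_subst: "degree (linear_subst m p \<alpha> \<beta> \<gamma> \<delta>) \<le> m"
  unfolding linear_subst_def
proof (intro degree_sum_le)
  fix i assume "i \<in> {..m}"
  then show "degree (smult (coeff p i) ([:\<beta>, \<alpha>:] ^ i * [:\<delta>, \<gamma>:] ^ (m - i))) \<le> m"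
    using degree_linear_powers[of \<beta> \<alpha> i \<delta> \<gamma> "m - i"] degree_smult_le order.trans by fastforce
qed simp

lemma represents_pre_moebius:
  assumes "represents m p q f" "\<alpha> * \<delta> - \<beta> * \<gamma> \<noteq> 0"
  shows "represents m (linear_subst m p \<alpha> \<beta> \<gamma> \<delta>) (linear_subst m q \<alpha> \<beta> \<gamma> \<delta>) (f \<circ> moebius \<alpha> \<beta> \<gamma> \<delta>)"
  unfolding represents_def
proof (intro conjI allI impI)
  fix u v :: complex assume uv: "u \<noteq> 0 \<or> v \<noteq> 0"
  show "homog m (linear_subst m p \<alpha> \<beta> \<gamma> \<delta>) u v \<noteq> 0 \<or> homog m (linear_subst m q \<alpha> \<beta> \<gamma> \<delta>) u v \<noteq> 0"
    and "(f \<circ> moebius \<alpha> \<beta> \<gamma> \<delta>) (hom_point u v) = hom_point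
      (homog m (linear_subst m p \<alpha> \<beta> \<gamma> \<delta>) u v) (homog m (linear_subst m q \<alpha> \<beta> \<gamma> \<delta>) u v)"
    using assms(1) det_vector_nonzero[OF assms(2) uv] unfolding represents_def
    by (simp_all add: homog_linear_subst moebius_hom_point[OF uv])
qed (rule degree_linear_subst)+

lemma Rat_conj:
  assumes "T \<in> PSL2" "\<phi> \<in> Rat d"
  shows "T \<circ> \<phi> \<circ> inv T \<in> Rat d"
proof -
  obtain a b c e where T: "a * e - b * c \<noteq> 0" "T = moebius a b c e"
    using assms(1) by (rule PSL2_cases)
  obtain a' b' c' e' where T': "a' * e' - b' * c' \<noteq> 0" "inv T = moebius a' b' c' e'"
    using PSL2_inv[OF assms(1)] by (rule PSL2_cases)
  obtain p q where "represents d p q \<phi>" using assms(2) by (auto simp: Rat_eq)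
  from represents_pre_moebius[OF represents_post_moebius[OF this T(1)] T'(1)]
  show ?thesis unfolding Rat_eq T(2)[symmetric] T'(2)[symmetric] by blast
qed

section \<open>Commutation as a reflection of coefficients\<close>

lemma homog_cnj: "homog d (map_poly cnj p) u v = cnj (homog d p (cnj u) (cnj v))"
  by (simp add: homog_def coeff_map_poly)

text \<open>The polynomial \<open>z\<^sup>d p(\<epsilon> / z)\<close>, for \<open>p\<close> of degree at most \<open>d\<close>.\<close>

definition scaled_reversal :: "nat \<Rightarrow> complex \<Rightarrow> complex poly \<Rightarrow> complex poly" where
  "scaled_reversal d \<epsilon> p = (\<Sum>i\<le>d. monom (\<epsilon> ^ (d - i) * coeff p (d - i)) i)"

lemma coeff_scaled_reversal:
  "coeff (scaled_reversal d \<epsilon> p) i = (if i \<le> d then \<epsilon> ^ (d - i) * coeff p (d - i) else 0)"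
  by (simp add: scaled_reversal_def coeff_sum)

lemma homog_scaled_reversal: "homog d (scaled_reversal d \<epsilon> p) u v = homog d p (\<epsilon> * v) u"
proof -
  have "homog d (scaled_reversal d \<epsilon> p) u v =
     (\<Sum>i\<le>d. \<epsilon> ^ (d - i) * coeff p (d - i) * u ^ i * v ^ (d - i))"
    by (simp add: homog_def coeff_scaled_reversal)
  also have "\<dots> = (\<Sum>i\<le>d. \<epsilon> ^ (d - (d - i)) * coeff p (d - (d - i)) * u ^ (d - i) * v ^ (d - (d - i)))"
    by (rule sum.reindex_bij_witness[of _ "\<lambda>i. d - i" "\<lambda>i. d - i"]) auto
  also have "\<dots> = homog d p (\<epsilon> * v) u"
    unfolding homog_def by (intro sum.cong) (auto simp: power_mult_distrib)
  finally show ?thesis .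
qed

lemma degree_scaled_reversal: "degree (scaled_reversal d \<epsilon> p) \<le> d"
  by (rule degree_le) (simp add: coeff_scaled_reversal)

lemma represents_smult:
  assumes "represents d p q f" "c \<noteq> 0"
  shows "represents d (smult c p) (smult c q) f"
  using assms by (auto simp: represents_def hom_point_mult)

lemma represents_determines: "represents d p q f \<Longrightarrow> represents d p q g \<Longrightarrow> f = g"
  by (simp add: represents_iff)

text \<open>
  Composing \<open>f \<circ> anti_inversion \<epsilon>\<close> and \<open>anti_inversion \<epsilon> \<circ> f\<close> with \<open>J\<close> makes both holomorphic: the
  first is represented by the reversals of \<open>p\<close> and \<open>q\<close>, the second by \<open>\<epsilon> cnj q\<close> and \<open>cnj p\<close>, with
  coefficients conjugated. By uniqueness of the representing pair they agree iff the two pairs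
  are proportional.
\<close>

lemma commutes_anti_inversion_iff:
  assumes f: "represents d p q f" and \<epsilon>: "\<epsilon> \<noteq> 0"
  shows "f \<circ> anti_inversion \<epsilon> = anti_inversion \<epsilon> \<circ> f \<longleftrightarrow>
    (\<exists>c. c \<noteq> 0 \<and> (\<forall>i\<le>d. coeff p i * \<epsilon> ^ i = c * \<epsilon> * cnj (coeff q (d - i)) \<and>
                        coeff q i * \<epsilon> ^ i = c * cnj (coeff p (d - i))))" (is "_ \<longleftrightarrow> ?R")
proof -
  have fD: "degree p \<le> d" "degree q \<le> d"
    "\<And>u v. u \<noteq> 0 \<or> v \<noteq> 0 \<Longrightarrow> homog d p u v \<noteq> 0 \<or> homog d q u v \<noteq> 0"
    "\<And>u v. u \<noteq> 0 \<or> v \<noteq> 0 \<Longrightarrow> f (hom_point u v) = hom_point (homog d p u v) (homog d q u v)"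
    using f unfolding represents_def by blast+
  define P Q where "P = scaled_reversal d \<epsilon> p" and "Q = scaled_reversal d \<epsilon> q"
  define P' Q' where "P' = smult \<epsilon> (map_poly cnj q)" and "Q' = map_poly cnj p"
  have 1: "represents d P Q (f \<circ> anti_inversion \<epsilon> \<circ> J)"
    unfolding represents_def P_def Q_def
  proof (intro conjI allI impI)
    fix u v :: complex assume uv: "u \<noteq> 0 \<or> v \<noteq> 0"
    then have "\<epsilon> * v \<noteq> 0 \<or> u \<noteq> 0" using \<epsilon> by auto
    note * = fD(3,4)[OF this]
    show "homog d (scaled_reversal d \<epsilon> p) u v \<noteq> 0 \<or> homog d (scaled_reversal d \<epsilon> q) u v \<noteq> 0"
      using *(1) by (simp add: homog_scaled_reversal)
    show "(f \<circ> anti_inversion \<epsilon> \<circ> J) (hom_point u v) =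
       hom_point (homog d (scaled_reversal d \<epsilon> p) u v) (homog d (scaled_reversal d \<epsilon> q) u v)"
      using *(2) uv \<epsilon> by (simp add: J_hom_point anti_inversion_hom_point homog_scaled_reversal)
  qed (rule degree_scaled_reversal)+
  have 2: "represents d P' Q' (anti_inversion \<epsilon> \<circ> f \<circ> J)"
    unfolding represents_def P'_def Q'_def
  proof (intro conjI allI impI)
    show "degree (smult \<epsilon> (map_poly cnj q)) \<le> d" "degree (map_poly cnj p) \<le> d"
      using fD(1,2) \<epsilon> by (simp_all add: degree_map_poly)
    fix u v :: complex assume "u \<noteq> 0 \<or> v \<noteq> 0"
    then have "cnj u \<noteq> 0 \<or> cnj v \<noteq> 0" by simp
    note * = fD(3,4)[OF this]
    show "homog d (smult \<epsilon> (map_poly cnj q)) u v \<noteq> 0 \<or> homog d (map_poly cnj p) u v \<noteq> 0"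
      using *(1) \<epsilon> by (auto simp: homog_cnj)
    show "(anti_inversion \<epsilon> \<circ> f \<circ> J) (hom_point u v) =
           hom_point (homog d (smult \<epsilon> (map_poly cnj q)) u v) (homog d (map_poly cnj p) u v)"
      using * \<epsilon> by (simp add: J_hom_point anti_inversion_hom_point homog_cnj)
  qed
  have "f \<circ> anti_inversion \<epsilon> = anti_inversion \<epsilon> \<circ> f \<longleftrightarrow>
        f \<circ> anti_inversion \<epsilon> \<circ> J = anti_inversion \<epsilon> \<circ> f \<circ> J"
    by (metis J_J(1) comp_assoc comp_id)
  also have "\<dots> \<longleftrightarrow> (\<exists>c. c \<noteq> 0 \<and> P = smult c P' \<and> Q = smult c Q')"
  proof
    assume "f \<circ> anti_inversion \<epsilon> \<circ> J = anti_inversion \<epsilon> \<circ> f \<circ> J"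
    with represents_unique[OF 2] 1 show "\<exists>c. c \<noteq> 0 \<and> P = smult c P' \<and> Q = smult c Q'"
      by metis
  next
    assume "\<exists>c. c \<noteq> 0 \<and> P = smult c P' \<and> Q = smult c Q'"
    with represents_smult[OF 2] 1 represents_determines
    show "f \<circ> anti_inversion \<epsilon> \<circ> J = anti_inversion \<epsilon> \<circ> f \<circ> J" by metis
  qed
  also have "\<dots> \<longleftrightarrow> ?R"
  proof (intro ex_cong1 conj_cong refl)
    fix c
    have "coeff p i = 0" "coeff q i = 0" if "d < i" for i
      using that fD(1,2) by (simp_all add: coeff_eq_0)
    then have "P = smult c P' \<longleftrightarrow> (\<forall>i\<le>d. coeff P i = coeff (smult c P') i)"
         "Q = smult c Q' \<longleftrightarrow> (\<forall>i\<le>d. coeff Q i = coeff (smult c Q') i)"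
      unfolding poly_eq_iff P_def Q_def P'_def Q'_def
      by (auto simp: coeff_scaled_reversal coeff_map_poly not_le)
    moreover have rev: "(\<forall>i\<le>d. A i) \<longleftrightarrow> (\<forall>i\<le>d. A (d - i))" for A
      by (metis diff_diff_cancel diff_le_self)
    ultimately show "P = smult c P' \<and> Q = smult c Q' \<longleftrightarrow>
       (\<forall>i\<le>d. coeff p i * \<epsilon> ^ i = c * \<epsilon> * cnj (coeff q (d - i)) \<and>
              coeff q i * \<epsilon> ^ i = c * cnj (coeff p (d - i)))"
      by (subst rev) (auto simp: P_def Q_def P'_def Q'_def coeff_scaled_reversal coeff_map_poly mult_ac)
  qed
  finally show ?thesis .
qed

section \<open>The maps phi_hat\<close>

lemma degree_psi_num: "degree (psi_num r a) \<le> r"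
  unfolding psi_num_def by (rule degree_sum_le) (auto intro: order.trans[OF degree_monom_le])

text \<open>Facts about the numerator then apply to the denominator as well.\<close>

lemma psi_den_eq: "psi_den r a = psi_num r (\<lambda>k. (-1) ^ k * cnj (a (r - k)))"
  by (simp add: psi_den_def psi_num_def)

lemma coeff_psi_num: "coeff (psi_num r a) k = (if k \<le> r then a k else 0)"
  by (simp add: psi_num_def coeff_sum)

lemma coeff_psi_num_subst:
  assumes "n > 0"
  shows "coeff (pcompose (psi_num r a) (monom 1 n)) j = (if n dvd j \<and> j \<le> n * r then a (j div n) else 0)"
proof -
  have "pcompose (psi_num r a) (monom 1 n) = (\<Sum>k\<le>r. monom (a k) (n * k))"
    by (subst poly_eq_poly_eq_iff[symmetric])
       (simp add: fun_eq_iff psi_num_def poly_pcompose poly_sum poly_monom power_mult)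
  then have "coeff (pcompose (psi_num r a) (monom 1 n)) j = (\<Sum>k\<le>r. if n * k = j then a k else 0)"
    by (simp add: coeff_sum)
  also have "\<dots> = (\<Sum>k\<in>{k. k \<le> r \<and> n * k = j}. a k)"
    by (rule sum.mono_neutral_cong_right) auto
  also have "{k. k \<le> r \<and> n * k = j} = (if n dvd j \<and> j \<le> n * r then {j div n} else {})"
    using assms by (auto simp: div_le_mono)
  finally show ?thesis by simp
qed

lemma even_Ints_quotient_iff:
  assumes "n > 0"
  shows "real m / real n \<in> even_Ints \<longleftrightarrow> 2 * n dvd m"
proof
  assume "real m / real n \<in> even_Ints"
  then obtain k :: int where "even k" "real m / real n = real_of_int k"
    by (auto simp: even_Ints_def)
  then have "real_of_int (int m) = real_of_int (k * int n)"
    using assms by (simp add: field_simps)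
  then have "int m = k * int n" by linarith
  with \<open>even k\<close> have "int (2 * n) dvd int m" by (auto simp: mult_dvd_mono)
  then show "2 * n dvd m" by (simp only: of_nat_dvd_iff)
next
  assume "2 * n dvd m"
  then obtain k where "m = 2 * n * k" by blast
  then have "real m / real n = real_of_int (int (2 * k))" using assms by simp
  then show "real m / real n \<in> even_Ints"
    unfolding even_Ints_def by (intro image_eqI[of _ _ "int (2 * k)"]) simp_all
qed

lemma not_both_dvd:
  fixes n d :: nat
  assumes "n \<ge> 2" "d \<ge> 2" "2 * n dvd d - 1" "2 * n dvd d + 1"
  shows False
proof -
  have "2 * n dvd (d + 1) - (d - 1)" by (rule dvd_diff_nat[OF assms(4,3)])
  also have "(d + 1) - (d - 1) = 2" using assms(2) by simp
  finally show False using assms(1) by (auto dest: dvd_imp_le)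
qed

text \<open>
  Numerator and denominator have degree at most \<open>r\<close>, and \<open>r\<close> is reached after cancelling the
  greatest common divisor; so nothing can have been cancelled.
\<close>

lemma psi_in_Rat_imp_coprime:
  assumes "psi r a \<in> Rat r" "r > 0" "a r \<noteq> 0 \<or> a 0 \<noteq> 0"
  shows "coprime (psi_num r a) (psi_den r a)"
proof -
  define g where "g = gcd (psi_num r a) (psi_den r a)"
  define p q where "p = psi_num r a div g" and "q = psi_den r a div g"
  have pq: "psi_num r a = p * g" "psi_den r a = q * g"
    by (simp_all add: p_def q_def g_def)
  have "psi_num r a \<noteq> 0"
    using assms(3) coeff_psi_num[of r a r] coeff_psi_num[of r a 0] by auto
  then have cop: "coprime p q" and g0: "g \<noteq> 0"
    unfolding p_def q_def g_def by (auto intro: div_gcd_coprime)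
  have "psi r a = rat_map p q"
    unfolding psi_def rat_map_def[abs_def] using cop
    by (simp add: coprime_iff_gcd_eq_1 fun_eq_iff flip: g_def p_def q_def)
  moreover obtain P Q where "represents r P Q (psi r a)"
    using assms(1) by (auto simp: Rat_eq)
  ultimately have "max (degree p) (degree q) = r"
    using represents_unique[of r P Q "psi r a" "max (degree p) (degree q)" p q] cop
    by (auto simp: represents_iff)
  moreover have "degree p + degree g \<le> r" if "p \<noteq> 0"
    using degree_psi_num[of r a] that g0 by (simp add: pq degree_mult_eq)
  moreover have "degree q + degree g \<le> r" if "q \<noteq> 0"
    using degree_psi_num[of r "(\<lambda>k. (-1) ^ k * cnj (a (r - k)))"] that g0
    by (simp add: pq degree_mult_eq flip: psi_den_eq)
  ultimately have "degree g = 0"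
    using assms(2) by (cases "p = 0"; cases "q = 0") (auto simp: max_def split: if_splits)
  with g0 have "is_unit g" by (subst is_unit_iff_degree)
  then show ?thesis unfolding g_def by (simp only: is_unit_gcd)
qed

abbreviation num_subst :: "nat \<Rightarrow> nat \<Rightarrow> (nat \<Rightarrow> complex) \<Rightarrow> complex poly" where
  "num_subst n r a \<equiv> pcompose (psi_num r a) (monom 1 n)"

abbreviation den_subst :: "nat \<Rightarrow> nat \<Rightarrow> (nat \<Rightarrow> complex) \<Rightarrow> complex poly" where
  "den_subst n r a \<equiv> pcompose (psi_den r a) (monom 1 n)"

lemma coeff_den_subst:
  assumes "n > 0"
  shows "coeff (den_subst n r a) j =
    (if n dvd j \<and> j \<le> n * r then (-1) ^ (j div n) * cnj (a (r - j div n)) else 0)"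
  unfolding psi_den_eq coeff_psi_num_subst[OF assms] ..

lemma not_dvd_mult_add_1:
  fixes n r :: nat
  assumes "n \<ge> 2"
  shows "\<not> n dvd n * r + 1"
proof
  assume "n dvd n * r + 1"
  then have "n dvd 1" using dvd_add_right_iff[of n "n * r" 1] by simp
  with assms show False by simp
qed

text \<open>
  The relation between the coefficients of \<open>psi_num\<close> and \<open>psi_den\<close> is the reflection of
  \<open>commutes_anti_inversion_iff\<close> for the pair \<open>(z A(z\<^sup>n), B(z\<^sup>n))\<close> in degree \<open>n r + 1\<close>: the
  signs \<open>(-1)\<^sup>k\<close> are the powers \<open>\<epsilon>\<^sup>n\<^sup>k\<close>, and evenness of \<open>r\<close> makes them symmetric under
  \<open>k \<mapsto> r - k\<close>.
\<close>

lemma num_den_reflection: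
  fixes a :: "nat \<Rightarrow> complex"
  assumes "n \<ge> 2" "even r" "i \<le> n * r + 1"
  defines "\<epsilon> \<equiv> exp (complex_of_real pi * \<i> / of_nat n)"
  defines "p \<equiv> [:0, 1:] * num_subst n r a" and "q \<equiv> den_subst n r a"
  shows "coeff p i * \<epsilon> ^ i = \<epsilon> * cnj (coeff q (n * r + 1 - i))"
    and "coeff q i * \<epsilon> ^ i = cnj (coeff p (n * r + 1 - i))"
proof -
  have n: "n > 0" using assms(1) by simp
  note \<epsilon> = primitive_2n_root_powers[OF n, folded \<epsilon>_def]
  have p0: "coeff p 0 = 0" by (simp add: p_def)
  have pS: "coeff p (Suc j) = (if n dvd j \<and> j \<le> n * r then a (j div n) else 0)" for j
    by (simp add: p_def coeff_psi_num_subst[OF n])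
  have q: "coeff q j = (if n dvd j \<and> j \<le> n * r then (-1) ^ (j div n) * cnj (a (r - j div n)) else 0)" for j
    by (simp add: q_def coeff_den_subst[OF n])
  have dvd_rev: "n dvd n * r - j \<longleftrightarrow> n dvd j" if "j \<le> n * r" for j
    using that by (metis dvd_diff_nat dvd_triv_left diff_diff_cancel)
  have sgn: "(-1) ^ (r - k) = ((-1) ^ k :: complex)" if "k \<le> r" for k
    using assms(2) that by (simp add: minus_one_power_iff)
  show "coeff p i * \<epsilon> ^ i = \<epsilon> * cnj (coeff q (n * r + 1 - i))"
  proof (cases i)
    case 0
    then show ?thesis using not_dvd_mult_add_1[OF assms(1)] by (simp add: p0 q)
  next
    case (Suc j)
    then have j: "j \<le> n * r" using assms(3) by simp
    show ?thesis
    proof (cases "n dvd j")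
      case True
      then obtain k where k: "j = n * k" by blast
      with j n have kr: "k \<le> r" by simp
      have "n * r - n * k = n * (r - k)" by (simp add: diff_mult_distrib2)
      with kr n show ?thesis
        by (simp add: Suc k pS q sgn power_mult \<epsilon>(2))
    qed (use j dvd_rev in \<open>simp add: Suc pS q\<close>)
  qed
  show "coeff q i * \<epsilon> ^ i = cnj (coeff p (n * r + 1 - i))"
  proof (cases "i \<le> n * r \<and> n dvd i")
    case True
    then obtain k where k: "i = n * k" by blast
    with True n have kr: "k \<le> r" by simp
    have "n * r - n * k = n * (r - k)" by (simp add: diff_mult_distrib2)
    with kr n show ?thesis
      by (simp add: k Suc_diff_le pS q power_mult \<epsilon>(2) flip: power_mult_distrib)
  next
    case False
    then have "coeff p (n * r + 1 - i) = 0"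
      using assms(3) dvd_rev by (cases "i \<le> n * r") (auto simp: Suc_diff_le pS p0)
    with False show ?thesis by (auto simp: q)
  qed
qed

lemma no_common_root_subst:
  assumes "coprime (psi_num r a) (psi_den r a)" "z \<noteq> 0"
  shows "poly ([:0, 1:] * num_subst n r a) z \<noteq> 0 \<or> poly (den_subst n r a) z \<noteq> 0"
  using coprime_poly_0[OF assms(1), of "z ^ n"] assms(2) by (simp add: poly_pcompose poly_monom)

lemma coprime_psiI:
  assumes "n > 0" "a 0 \<noteq> 0 \<or> a r \<noteq> 0"
    and "\<And>z. z \<noteq> 0 \<Longrightarrow> poly ([:0, 1:] * num_subst n r a) z \<noteq> 0 \<or> poly (den_subst n r a) z \<noteq> 0"
  shows "coprime (psi_num r a) (psi_den r a)"
proof (rule coprime_if_no_common_root)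
  fix w :: complex
  show "poly (psi_num r a) w \<noteq> 0 \<or> poly (psi_den r a) w \<noteq> 0"
  proof (cases "w = 0")
    case True
    then show ?thesis
      using assms(2) by (simp add: poly_0_coeff_0 coeff_psi_num psi_den_eq)
  next
    case False
    obtain z where z: "z ^ n = w" using nth_root_exists[OF assms(1)] by blast
    with False assms(1) have "z \<noteq> 0" by auto
    from assms(3)[OF this] show ?thesis by (auto simp: poly_pcompose poly_monom z)
  qed
qed

lemma psi_in_Rat:
  assumes "coprime (psi_num r a) (psi_den r a)" "a 0 \<noteq> 0 \<or> a r \<noteq> 0"
  shows "psi r a \<in> Rat r"
proof -
  have le: "degree (psi_num r a) \<le> r" "degree (psi_den r a) \<le> r"
    unfolding psi_den_eq by (rule degree_psi_num)+
  have "coeff (psi_num r a) r = a r" "coeff (psi_den r a) r = (-1) ^ r * cnj (a 0)"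
    unfolding psi_den_eq coeff_psi_num by simp_all
  with assms(2) have "degree (psi_num r a) \<ge> r \<or> degree (psi_den r a) \<ge> r"
    by (auto intro!: le_degree)
  with le have "max (degree (psi_num r a)) (degree (psi_den r a)) = r" by linarith
  with assms(1) show ?thesis unfolding Rat_def psi_def by blast
qed

lemma rat_map_cancel_X:
  assumes "coprime p q"
  shows "rat_map ([:0, 1:] * p) ([:0, 1:] * q) = rat_map p q"
proof -
  have "gcd ([:0, 1:] * p) ([:0, 1:] * q) = [:0, 1:]"
    using assms
    by (subst gcd_mult_left) (simp add: coprime_iff_gcd_eq_1 normalize_poly_def flip: one_pCons)
  then have "rat_map ([:0, 1:] * p) ([:0, 1:] * q) =
      rat_map (([:0, 1:] * p) div [:0, 1:]) (([:0, 1:] * q) div [:0, 1:])"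
    using assms by (simp add: rat_map_def[abs_def] fun_eq_iff coprime_iff_gcd_eq_1 del: mult_pCons_left)
  then show ?thesis by (simp del: mult_pCons_left)
qed

text \<open>
  For \<open>a r \<noteq> 0\<close> the fraction defining \<open>phi_hat\<close> is already in lowest terms, because the constant
  term of the denominator is \<open>cnj (a r)\<close>.
\<close>

lemma phi_hat_represents_numerator_top:
  assumes "n > 0" "coprime (psi_num r a) (psi_den r a)" "a r \<noteq> 0"
  shows "represents (n * r + 1) ([:0, 1:] * num_subst n r a) (den_subst n r a) (phi_hat n r a)"
  unfolding represents_iff
proof (intro conjI)
  let ?p = "[:0, 1:] * num_subst n r a" and ?q = "den_subst n r a"
  show "coprime ?p ?q"
  proof (rule coprime_if_no_common_root)
    fix z
    show "poly ?p z \<noteq> 0 \<or> poly ?q z \<noteq> 0"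
    proof (cases "z = 0")
      case True
      then show ?thesis
        using assms(1,3)
        by (simp add: poly_pcompose poly_monom poly_0_coeff_0 psi_den_eq coeff_psi_num)
    next
      case False
      then show ?thesis by (rule no_common_root_subst[OF assms(2)])
    qed
  qed
  have "degree ?p \<le> n * r + 1" "degree ?q \<le> n * r + 1"
    using assms(1)
    by (auto intro!: degree_le simp: coeff_psi_num_subst coeff_den_subst coeff_pCons split: nat.split)
  moreover have "coeff ?p (n * r + 1) \<noteq> 0"
    using assms(1,3) by (simp add: coeff_psi_num_subst)
  then have "n * r + 1 \<le> degree ?p" by (rule le_degree)
  ultimately show "max (degree ?p) (degree ?q) = n * r + 1"
    by linarith
  show "phi_hat n r a = rat_map ?p ?q"
    by (simp add: phi_hat_def fun_eq_iff)
qed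

text \<open>
  For \<open>a r = 0\<close> the denominator vanishes at \<open>0\<close> as well, so exactly one factor \<open>z\<close> cancels; the
  degree drops to \<open>n r - 1\<close>, which is attained by the denominator, with leading coefficient
  \<open>cnj (a 0)\<close> up to sign.
\<close>

lemma phi_hat_represents_numerator_short:
  assumes "n \<ge> 2" "r > 0" "coprime (psi_num r a) (psi_den r a)" "a r = 0" "a 0 \<noteq> 0"
  obtains q where "den_subst n r a = [:0, 1:] * q"
    "represents (n * r - 1) (num_subst n r a) q (phi_hat n r a)"
proof -
  have n: "n > 0" using assms(1) by simp
  let ?p = "num_subst n r a"
  have "poly (den_subst n r a) 0 = 0"
    using assms(4) n
    by (simp add: poly_pcompose poly_monom poly_0_coeff_0 psi_den_eq coeff_psi_num)
  then obtain q where q: "den_subst n r a = [:0, 1:] * q"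
    by (auto simp: poly_eq_0_iff_dvd)
  have coeff_q: "coeff q j = coeff (den_subst n r a) (Suc j)" for j
    by (simp add: q)
  have nr: "n * r \<ge> 2" using mult_le_mono[OF assms(1), of 1 r] assms(2) by simp
  have cop: "coprime ?p q"
  proof (rule coprime_if_no_common_root)
    fix z
    show "poly ?p z \<noteq> 0 \<or> poly q z \<noteq> 0"
    proof (cases "z = 0")
      case True
      then show ?thesis
        using n assms(5) by (simp add: poly_pcompose poly_monom poly_0_coeff_0 coeff_psi_num)
    next
      case False
      then show ?thesis using no_common_root_subst[OF assms(3) False, of n] by (auto simp: q)
    qed
  qed
  have "degree ?p \<le> n * r - 1"
  proof (rule degree_le, intro allI impI)
    fix i assume "i > n * r - 1"
    then show "coeff ?p i = 0"
      using assms(4) n by (cases "i = n * r") (auto simp: coeff_psi_num_subst)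
  qed
  moreover have "degree q \<le> n * r - 1"
    using n nr by (auto intro!: degree_le simp: coeff_q coeff_den_subst)
  moreover have "Suc (n * r - 1) = n * r" using nr by simp
  then have "coeff q (n * r - 1) \<noteq> 0"
    unfolding coeff_q using n assms(5) by (simp add: coeff_den_subst)
  then have "n * r - 1 \<le> degree q" by (rule le_degree)
  ultimately have "max (degree ?p) (degree q) = n * r - 1"
    by linarith
  moreover have "phi_hat n r a = rat_map ?p q"
    unfolding phi_hat_def q by (rule rat_map_cancel_X[OF cop])
  ultimately show ?thesis using cop q that by (simp add: represents_iff)
qed

lemma phi_hat_commutes_tau:
  assumes "n \<ge> 2" "even r" "r > 0" "coprime (psi_num r a) (psi_den r a)"
  shows "a r \<noteq> 0 \<Longrightarrow> d = n * r + 1 \<Longrightarrow>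
      phi_hat n r a \<in> Rat d \<and> phi_hat n r a \<circ> tau n = tau n \<circ> phi_hat n r a"
    and "a r = 0 \<Longrightarrow> a 0 \<noteq> 0 \<Longrightarrow> d + 1 = n * r \<Longrightarrow>
      phi_hat n r a \<in> Rat d \<and> phi_hat n r a \<circ> tau n = tau n \<circ> phi_hat n r a"
proof -
  have n: "n > 0" using assms(1) by simp
  define \<epsilon> where "\<epsilon> = exp (complex_of_real pi * \<i> / of_nat n)"
  have \<epsilon>0: "\<epsilon> \<noteq> 0" by (simp add: \<epsilon>_def)
  note refl = num_den_reflection[OF assms(1,2), folded \<epsilon>_def]
  have tau: "tau n = anti_inversion \<epsilon>" by (simp add: tau_eq_anti_inversion \<epsilon>_def)
  show "phi_hat n r a \<in> Rat d \<and> phi_hat n r a \<circ> tau n = tau n \<circ> phi_hat n r a"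
    if ar: "a r \<noteq> 0" and d: "d = n * r + 1"
  proof
    note rep = phi_hat_represents_numerator_top[OF n assms(4) ar, folded d]
    then show "phi_hat n r a \<in> Rat d" by (auto simp: Rat_eq)
    show "phi_hat n r a \<circ> tau n = tau n \<circ> phi_hat n r a"
      unfolding tau commutes_anti_inversion_iff[OF rep \<epsilon>0] d
      using refl by (intro exI[of _ 1]) (simp del: mult_pCons_left)
  qed
  show "phi_hat n r a \<in> Rat d \<and> phi_hat n r a \<circ> tau n = tau n \<circ> phi_hat n r a"
    if ar: "a r = 0" "a 0 \<noteq> 0" and d: "d + 1 = n * r"
  proof
    obtain q where q: "den_subst n r a = [:0, 1:] * q"
      and rep: "represents (n * r - 1) (num_subst n r a) q (phi_hat n r a)"
      using phi_hat_represents_numerator_short[OF assms(1,3,4) ar] .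
    have d': "n * r - 1 = d" using d by simp
    note rep = rep[unfolded d']
    then show "phi_hat n r a \<in> Rat d" by (auto simp: Rat_eq)
    let ?p = "num_subst n r a"
    \<comment> \<open>cancelling \<open>z\<close> shifts the index by one, which costs the factor \<open>1 / \<epsilon>\<close>\<close>
    have "coeff ?p i * \<epsilon> ^ i = inverse \<epsilon> * \<epsilon> * cnj (coeff q (d - i)) \<and>
          coeff q i * \<epsilon> ^ i = inverse \<epsilon> * cnj (coeff ?p (d - i))" if "i \<le> d" for i
    proof -
      have "Suc i \<le> n * r + 1" using that d by simp
      note refl[OF this, of a, unfolded q]
      moreover have "n * r + 1 - Suc i = Suc (d - i)" using that d by simp
      ultimately show ?thesis using \<epsilon>0 by (simp add: field_simps)
    qed
    with \<epsilon>0 show "phi_hat n r a \<circ> tau n = tau n \<circ> phi_hat n r a"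
      unfolding tau commutes_anti_inversion_iff[OF rep \<epsilon>0]
      by (intro exI[of _ "inverse \<epsilon>"]) simp
  qed
qed

section \<open>Rational maps commuting with tau\<close>

text \<open>
  Going from index \<open>i\<close> to the reflected index \<open>j\<close> and back multiplies \<open>x\<close> by a known number, which
  must be \<open>1\<close> as \<open>x \<noteq> 0\<close>. Its modulus determines \<open>\<bar>c\<bar>\<close>, its argument constrains \<open>i\<close>.
\<close>

lemma reflection_unimodular:
  fixes x y c \<epsilon> e e' :: complex
  assumes "x \<noteq> 0" "norm \<epsilon> = 1" "norm e = 1" "norm e' = 1"
    and "x * \<epsilon> ^ i = c * e * cnj y" and "y * \<epsilon> ^ j = c * e' * cnj x"
  shows "norm c = 1" and "\<epsilon> ^ i = e * cnj e' * \<epsilon> ^ j"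
proof -
  have "x * \<epsilon> ^ i * cnj (\<epsilon> ^ j) = c * e * cnj (y * \<epsilon> ^ j)"
    using assms(5) by simp
  also have "\<dots> = x * (c * cnj c * e * cnj e')"
    unfolding assms(6) by simp
  finally have eq: "\<epsilon> ^ i * cnj (\<epsilon> ^ j) = c * cnj c * e * cnj e'"
    using assms(1) by (simp add: mult.assoc)
  then have "norm (\<epsilon> ^ i * cnj (\<epsilon> ^ j)) = norm (c * cnj c * e * cnj e')" by (rule arg_cong)
  then have "norm c ^ 2 = 1"
    using assms(2-4) by (simp add: norm_mult norm_power power2_eq_square)
  then have "norm c = 1 \<or> norm c = - 1" by (simp only: power2_eq_1_iff)
  then show c: "norm c = 1" using norm_ge_zero[of c] by linarith
  have unit: "z * cnj z = 1" if "norm z = 1" for z :: complex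
    using that by (simp flip: complex_norm_square)
  have "\<epsilon> ^ i * (\<epsilon> ^ j * cnj (\<epsilon> ^ j)) = (c * cnj c) * e * cnj e' * \<epsilon> ^ j"
    using eq by (simp add: mult_ac)
  then show "\<epsilon> ^ i = e * cnj e' * \<epsilon> ^ j"
    using assms(2) c by (simp add: unit norm_power del: complex_cnj_power)
qed

text \<open>
  Multiplying \<open>p\<close> and \<open>q\<close> by \<open>s\<close> changes the constant \<open>c\<close> of the reflection to \<open>c s / cnj s\<close>.
  For \<open>\<bar>c\<bar> = 1\<close> an inverse square root \<open>s\<close> of \<open>c\<close> lies on the unit circle and makes this
  constant \<open>1\<close>, which is the relation between the coefficients of \<open>psi_num\<close> and \<open>psi_den\<close>.
\<close>

lemma psi_shape_of_reflected_pair: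
  assumes "n > 0" "norm c = 1"
  defines "\<epsilon> \<equiv> exp (complex_of_real pi * \<i> / of_nat n)"
  assumes p0: "coeff p 0 = 0"
    and p: "\<And>j. coeff p (Suc j) \<noteq> 0 \<Longrightarrow> n dvd j \<and> j \<le> n * r"
    and q: "\<And>j. coeff q j \<noteq> 0 \<Longrightarrow> n dvd j \<and> j \<le> n * r"
    and rel: "\<And>i. i \<le> n * r \<Longrightarrow> coeff q i * \<epsilon> ^ i = c * cnj (coeff p (n * r + 1 - i))"
  obtains s a where "s \<noteq> 0" "smult s p = [:0, 1:] * num_subst n r a"
    "smult s q = den_subst n r a" "\<And>k. a k = s * coeff p (n * k + 1)"
proof -
  define s where "s = inverse (csqrt c)"
  have s: "s \<noteq> 0" "s * c = cnj s"
  proof -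
    have "c \<noteq> 0" using assms(2) by auto
    then show "s \<noteq> 0" by (simp add: s_def)
    have "norm s = 1" using assms(2) by (simp add: s_def norm_inverse)
    moreover have "s * s * c = 1"
      using \<open>c \<noteq> 0\<close> by (simp add: s_def field_simps flip: power2_eq_square)
    ultimately show "s * c = cnj s"
      using \<open>s \<noteq> 0\<close> by (simp add: cnj_unit field_simps)
  qed
  define a where "a k = s * coeff p (n * k + 1)" for k
  have "coeff (smult s p) i = coeff ([:0, 1:] * num_subst n r a) i" for i
  proof (cases i)
    case (Suc j)
    then show ?thesis using p[of j] assms(1) by (auto simp: coeff_psi_num_subst a_def)
  qed (simp add: p0)
  moreover have "coeff (smult s q) i = coeff (den_subst n r a) i" for i
  proof (cases "n dvd i \<and> i \<le> n * r")
    case True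
    then obtain k where k: "i = n * k" by blast
    with True assms(1) have kr: "k \<le> r" by simp
    have "n * r - n * k = n * (r - k)" by (simp add: diff_mult_distrib2)
    with kr rel[of i] assms(1) have refl: "coeff q i * (-1) ^ k = c * cnj (coeff p (n * (r - k) + 1))"
      using primitive_2n_root_powers(2)[OF assms(1)] by (simp add: k power_mult \<epsilon>_def Suc_diff_le)
    have "coeff q i = (-1) ^ k * (coeff q i * (-1) ^ k)"
      by (simp add: mult.left_commute[of "(-1) ^ k"])
    then have "coeff q i = (-1) ^ k * (c * cnj (coeff p (n * (r - k) + 1)))"
      by (simp only: refl)
    with True assms(1) show ?thesis
      by (simp add: coeff_den_subst a_def k mult_ac flip: s(2))
  next
    case False
    then show ?thesis using q[of i] assms(1) by (auto simp: coeff_den_subst)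
  qed
  ultimately show ?thesis
    using that[of s a] s(1) by (simp add: poly_eq_iff a_def)
qed

text \<open>
  The reflection restricts the exponents in \<open>p\<close> to one residue class modulo \<open>n\<close> and those in \<open>q\<close> to
  the preceding one. Which class it is depends on which of \<open>p\<close> and \<open>q\<close> has a nonzero constant term;
  the two possibilities are the two conclusions.
\<close>

lemma commuting_with_tau_form:
  assumes "n \<ge> 2" "d \<ge> 2" "f \<in> Rat d" and comm: "f \<circ> tau n = tau n \<circ> f"
  obtains (top) r a where "d = n * r + 1" "even r" "f = phi_hat n r a" "psi r a \<in> Rat r" "a r \<noteq> 0"
  | (short) r a where "d + 1 = n * r" "even r" "f = phi_hat n r a" "psi r a \<in> Rat r" "a r = 0" "a 0 \<noteq> 0"
proof -
  have n: "n > 0" using assms(1) by simp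
  define \<epsilon> where "\<epsilon> = exp (complex_of_real pi * \<i> / of_nat n)"
  have \<epsilon>0: "\<epsilon> \<noteq> 0" by (simp add: \<epsilon>_def)
  note \<epsilon> = primitive_2n_root_powers[OF n, folded \<epsilon>_def]
  have tau: "tau n = anti_inversion \<epsilon>" by (simp add: tau_eq_anti_inversion \<epsilon>_def)
  obtain p q where rep: "represents d p q f" using assms(3) by (auto simp: Rat_eq)
  then have cop: "coprime p q" and f: "f = rat_map p q" and deg: "degree p \<le> d" "degree q \<le> d"
    by (auto simp: represents_iff)
  obtain c where c: "c \<noteq> 0"
    and rp: "\<And>i. i \<le> d \<Longrightarrow> coeff p i * \<epsilon> ^ i = c * \<epsilon> * cnj (coeff q (d - i))"
    and rq: "\<And>i. i \<le> d \<Longrightarrow> coeff q i * \<epsilon> ^ i = c * cnj (coeff p (d - i))"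
    using comm unfolding tau commutes_anti_inversion_iff[OF rep \<epsilon>0] by blast
  have range: "i \<le> d" if "coeff p i \<noteq> 0 \<or> coeff q i \<noteq> 0" for i
    using that deg le_degree order.trans by blast
  have P: "norm c = 1 \<and> [2 * i = d + 1] (mod 2 * n)" if "coeff p i \<noteq> 0" for i
  proof -
    have i: "i \<le> d" using range that by blast
    note u = reflection_unimodular[of "coeff p i" \<epsilon> \<epsilon> 1 i c "coeff q (d - i)" "d - i"]
    have "norm c = 1" "\<epsilon> ^ i = \<epsilon> * \<epsilon> ^ (d - i)"
      using u that \<epsilon>(1) rp[OF i] rq[of "d - i"] i by simp_all
    then have "\<epsilon> ^ (2 * i) = \<epsilon> ^ (i + Suc (d - i))"
      by (simp add: mult_2 power_add)
    also have "i + Suc (d - i) = d + 1" using i by simp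
    finally show ?thesis using \<open>norm c = 1\<close> \<epsilon>(3) by blast
  qed
  have Q: "norm c = 1 \<and> [2 * i + 1 = d] (mod 2 * n)" if "coeff q i \<noteq> 0" for i
  proof -
    have i: "i \<le> d" using range that by blast
    note u = reflection_unimodular[of "coeff q i" \<epsilon> 1 \<epsilon> i c "coeff p (d - i)" "d - i"]
    have "norm c = 1" "\<epsilon> ^ i = cnj \<epsilon> * \<epsilon> ^ (d - i)"
      using u that \<epsilon>(1) rq[OF i] rp[of "d - i"] i by simp_all
    then have "\<epsilon> ^ (2 * i + 1) = \<epsilon> ^ (i + (d - i))"
      using cnj_unit[OF \<epsilon>(1)] \<epsilon>0 by (simp add: mult_2 power_add)
    also have "i + (d - i) = d" using i by simp
    finally show ?thesis using \<open>norm c = 1\<close> \<epsilon>(3) by blast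
  qed
  have half: "[i = j] (mod n)" if "[2 * i = 2 * j] (mod 2 * n)" for i j
    using that by (simp add: cong_def mod_mult_mult1)
  have "poly p 0 \<noteq> 0 \<or> poly q 0 \<noteq> 0" by (rule coprime_poly_0[OF cop])
  then consider "coeff q 0 \<noteq> 0" | "coeff p 0 \<noteq> 0" by (auto simp: poly_0_coeff_0)
  then show ?thesis
  proof cases
    case 1
    have c1: "norm c = 1" and d1: "[d = 1] (mod 2 * n)" using Q[OF 1] by (auto simp: cong_sym_eq)
    then have "2 * n dvd d - 1" using assms(2) by (simp add: cong_altdef_nat)
    then obtain m where m: "d - 1 = 2 * n * m" by blast
    define r where "r = 2 * m"
    have d: "d = n * r + 1" and r: "even r" using m assms(2) by (simp_all add: r_def)
    have p_supp: "[i = 1] (mod n)" if "coeff p i \<noteq> 0" for i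
    proof -
      have "[2 * i = d + 1] (mod 2 * n)" using P[OF that] by simp
      also have "[d + 1 = 1 + 1] (mod 2 * n)" using d1 by (rule cong_add) simp
      finally show ?thesis by (intro half) (simp only: one_add_one mult_1_right)
    qed
    have q_supp: "n dvd j" if "coeff q j \<noteq> 0" for j
    proof -
      have "[2 * j + 1 = d] (mod 2 * n)" using Q[OF that] by simp
      also note d1
      finally have "[2 * j + 1 = 2 * 0 + 1] (mod 2 * n)" by simp
      then have "[2 * j = 2 * 0] (mod 2 * n)" by (simp only: cong_add_rcancel_nat)
      then show ?thesis using half[of j 0] by (simp add: cong_0_iff)
    qed
    have "coeff p 0 = 0"
      using p_supp[of 0] assms(1) by (auto simp: cong_def)
    moreover have "n dvd j \<and> j \<le> n * r" if "coeff p (Suc j) \<noteq> 0" for j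
      using p_supp[OF that] range[of "Suc j"] that d by (auto simp: cong_altdef_nat)
    moreover have "n dvd j \<and> j \<le> n * r" if "coeff q j \<noteq> 0" for j
    proof -
      have "j \<noteq> n * r + 1"
        using q_supp[OF that] not_dvd_mult_add_1[OF assms(1)] by auto
      then show ?thesis using q_supp[OF that] range[of j] that d by auto
    qed
    moreover have "coeff q i * \<epsilon> ^ i = c * cnj (coeff p (n * r + 1 - i))" if "i \<le> n * r" for i
      using rq[of i] that d by simp
    ultimately obtain s a where s: "s \<noteq> 0" "smult s p = [:0, 1:] * num_subst n r a"
       "smult s q = den_subst n r a" "\<And>k. a k = s * coeff p (n * k + 1)"
      using psi_shape_of_reflected_pair[OF n c1, folded \<epsilon>_def, of p r q] by blast
    have "coeff p d * \<epsilon> ^ d \<noteq> 0" using rp[of d] 1 c \<epsilon>0 by simp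
    then have ar: "a r \<noteq> 0" using s(1,4) d by simp
    have "f = phi_hat n r a"
      using represents_smult[OF rep s(1)] by (simp add: represents_iff phi_hat_def fun_eq_iff s(2,3))
    moreover have "coprime (psi_num r a) (psi_den r a)"
    proof (rule coprime_psiI[OF n])
      show "poly ([:0, 1:] * num_subst n r a) z \<noteq> 0 \<or> poly (den_subst n r a) z \<noteq> 0" for z
        using coprime_poly_0[OF cop, of z] s(1) unfolding s(2,3)[symmetric] by simp
    qed (use ar in simp)
    then have "psi r a \<in> Rat r" using ar by (intro psi_in_Rat) simp_all
    ultimately show ?thesis using top d r ar by blast
  next
    case 2
    have c1: "norm c = 1" and d1: "[d + 1 = 0] (mod 2 * n)" using P[OF 2] by (auto simp: cong_sym_eq)
    then have "2 * n dvd d + 1" by (simp add: cong_0_iff)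
    then obtain m where m: "d + 1 = 2 * n * m" by blast
    define r where "r = 2 * m"
    have d: "d + 1 = n * r" and r: "even r" using m by (simp_all add: r_def)
    have p_supp: "n dvd j" if "coeff p j \<noteq> 0" for j
    proof -
      have "[2 * j = d + 1] (mod 2 * n)" using P[OF that] by simp
      also note d1
      finally show ?thesis using half[of j 0] by (simp add: cong_0_iff)
    qed
    have q_supp: "n dvd Suc j" if "coeff q j \<noteq> 0" for j
    proof -
      have "[2 * j + 1 + 1 = d + 1] (mod 2 * n)" using Q[OF that] by (intro cong_add) simp_all
      also note d1
      finally show ?thesis using half[of "Suc j" 0] by (simp add: cong_0_iff)
    qed
    \<comment> \<open>exponents in \<open>p\<close> are now multiples of \<open>n\<close>; a factor \<open>z\<close> moves them to the class of \<open>1\<close>\<close>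
    let ?p = "[:0, 1:] * p" and ?q = "[:0, 1:] * q"
    have "coeff ?p 0 = 0" by simp
    moreover have "n dvd j \<and> j \<le> n * r" if "coeff ?p (Suc j) \<noteq> 0" for j
      using p_supp[of j] range[of j] that d by auto
    moreover have "n dvd j \<and> j \<le> n * r" if "coeff ?q j \<noteq> 0" for j
      using that q_supp[of "j - 1"] range[of "j - 1"] d by (cases j) auto
    moreover have "norm (c * \<epsilon>) = 1" using c1 \<epsilon>(1) by (simp add: norm_mult)
    moreover have "coeff ?q i * \<epsilon> ^ i = c * \<epsilon> * cnj (coeff ?p (n * r + 1 - i))" if "i \<le> n * r" for i
    proof (cases i)
      case 0
      have "coeff p (d + 1) = 0" using range[of "d + 1"] by auto
      with 0 d show ?thesis by simp
    next
      case (Suc j)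
      then have "j \<le> d" "n * r + 1 - i = Suc (d - j)" using that d by simp_all
      then show ?thesis using rq[of j] by (simp add: Suc)
    qed
    ultimately obtain s a where s: "s \<noteq> 0" "smult s ?p = [:0, 1:] * num_subst n r a"
       "smult s ?q = den_subst n r a" "\<And>k. a k = s * coeff ?p (n * k + 1)"
      using psi_shape_of_reflected_pair[OF n, folded \<epsilon>_def, of "c * \<epsilon>" ?p r ?q] by blast
    have a0: "a 0 \<noteq> 0" using s(1) 2 by (simp add: s(4))
    have "coeff p (n * r) = 0" using range[of "n * r"] d by auto
    then have ar: "a r = 0" by (simp add: s(4))
    have rep': "represents d (smult s p) (smult s q) f" by (rule represents_smult[OF rep s(1)])
    have "f = rat_map ([:0, 1:] * smult s p) ([:0, 1:] * smult s q)"
      using rep' by (simp only: represents_iff rat_map_cancel_X)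
    also have "\<dots> = phi_hat n r a"
      unfolding phi_hat_def[abs_def] s(2,3)[symmetric] by simp
    finally have "f = phi_hat n r a" .
    moreover have "coprime (psi_num r a) (psi_den r a)"
    proof (rule coprime_psiI[OF n])
      show "poly ([:0, 1:] * num_subst n r a) z \<noteq> 0 \<or> poly (den_subst n r a) z \<noteq> 0" if "z \<noteq> 0" for z
        using coprime_poly_0[OF cop, of z] s(1) that unfolding s(2,3)[symmetric] by simp
    qed (use a0 in simp)
    then have "psi r a \<in> Rat r" using a0 by (intro psi_in_Rat) simp_all
    ultimately show ?thesis using short d r ar a0 by blast
  qed
qed

lemma commutes_funpow: "f \<circ> g = g \<circ> f \<Longrightarrow> f \<circ> g ^^ k = g ^^ k \<circ> f"
  by (induction k) (simp, metis comp_assoc funpow.simps(2))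

lemma antihol_aut_iff: "antihol_aut \<phi> Q \<longleftrightarrow> Q \<in> ext_moebius \<and> \<phi> \<circ> Q = Q \<circ> \<phi>"
proof -
  have "Q \<circ> \<phi> \<circ> inv Q = \<phi> \<longleftrightarrow> \<phi> \<circ> Q = Q \<circ> \<phi>" if "bij Q"
  proof
    assume "Q \<circ> \<phi> \<circ> inv Q = \<phi>"
    then have "\<phi> \<circ> Q = Q \<circ> \<phi> \<circ> inv Q \<circ> Q" by simp
    also have "\<dots> = Q \<circ> \<phi>" using that by (simp add: comp_assoc bij_is_inj)
    finally show "\<phi> \<circ> Q = Q \<circ> \<phi>" .
  next
    assume "\<phi> \<circ> Q = Q \<circ> \<phi>"
    then have "Q \<circ> \<phi> \<circ> inv Q = \<phi> \<circ> (Q \<circ> inv Q)" by (simp add: comp_assoc[symmetric])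
    also have "\<dots> = \<phi>" using bij_is_surj[OF that] unfolding surj_iff by simp
    finally show "Q \<circ> \<phi> \<circ> inv Q = \<phi>" .
  qed
  then show ?thesis using ext_moebius_bij by (auto simp: antihol_aut_def)
qed

text \<open>
  A map commuting with \<open>\<tau>\<close> commutes with all powers of \<open>\<tau>\<close>, in particular with the power that is
  conjugate to \<open>tau n\<close>.
\<close>

lemma antihol_aut_conj_form:
  assumes "n \<ge> 2" "d \<ge> 2" "even n" "\<phi> \<in> Rat d" "antihol_aut \<phi> \<tau>" "has_order \<tau> (2 * n)"
  obtains T k where "T \<in> PSL2" "coprime k (2 * n)" "T \<circ> \<tau> ^^ k \<circ> inv T = tau n"
    "T \<circ> \<phi> \<circ> inv T \<in> Rat d" "(T \<circ> \<phi> \<circ> inv T) \<circ> tau n = tau n \<circ> (T \<circ> \<phi> \<circ> inv T)"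
proof -
  have \<tau>: "\<tau> \<in> ext_moebius" and comm: "\<phi> \<circ> \<tau> = \<tau> \<circ> \<phi>"
    using assms(5) by (auto simp: antihol_aut_iff)
  obtain T a where T: "T \<in> PSL2" "norm a = 1" "T \<circ> \<tau> \<circ> inv T = anti_inversion a"
    using ext_moebius_order_normal_form[OF \<tau> assms(6,1)] .
  note bT = PSL2_bij[OF T(1)]
  have "has_order (anti_inversion a) (2 * n)"
    using assms(6) has_order_conj[OF bT, where f = \<tau>] T(3) by simp
  then obtain k where k: "coprime k (2 * n)" "anti_inversion a ^^ k = tau n"
    using anti_inversion_power_eq_tau[OF T(2)] assms(1,3) by (metis gr0I not_numeral_le_zero)
  have tau: "T \<circ> \<tau> ^^ k \<circ> inv T = tau n"
    using conj_funpow[OF bT, where f = \<tau>] T(3) k(2) by simp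
  have mul: "(T \<circ> f \<circ> inv T) \<circ> (T \<circ> g \<circ> inv T) = T \<circ> (f \<circ> g) \<circ> inv T" for f g
    using bT by (simp add: fun_eq_iff bij_is_inj)
  have "(T \<circ> \<phi> \<circ> inv T) \<circ> tau n = tau n \<circ> (T \<circ> \<phi> \<circ> inv T)"
    unfolding tau[symmetric] mul commutes_funpow[OF comm] ..
  with T(1) k(1) tau Rat_conj[OF T(1) assms(4)] show ?thesis by (intro that)
qed

section \<open>Maps with an antiholomorphic automorphism of order 2n\<close>

theorem theorem4:
  fixes n d :: nat
  assumes "n \<ge> 2" and "d \<ge> 2" and "even n"
  shows
    "(\<forall>\<phi> \<tau>. \<phi> \<in> Rat d \<and> antihol_aut \<phi> \<tau> \<and> has_order \<tau> (2 * n) \<longrightarrow>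
        d \<ge> 3 \<and> odd d \<and>
        ((real d - 1) / real n \<in> even_Ints \<or> (real d + 1) / real n \<in> even_Ints) \<and>
        \<not> ((real d - 1) / real n \<in> even_Ints \<and> (real d + 1) / real n \<in> even_Ints) \<and>
        (\<forall>r::nat. even r \<and> real r \<in> {(real d - 1) / real n, (real d + 1) / real n} \<longrightarrow>
          (\<exists>T\<in>PSL2. \<exists>a :: nat \<Rightarrow> complex.
             T \<circ> \<phi> \<circ> inv T = phi_hat n r a \<and>
             psi r a \<in> Rat r \<and>
             (real r = (real d - 1) / real n \<longrightarrow> a r \<noteq> 0) \<and>
             (real r = (real d + 1) / real n \<longrightarrow> a r = 0 \<and> a 0 \<noteq> 0) \<and>
             (\<exists>k. coprime k (2 * n) \<and> T \<circ> (\<tau> ^^ k) \<circ> inv T = tau n))))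
     \<and>
     (d \<ge> 3 \<and> odd d \<and>
      ((real d - 1) / real n \<in> even_Ints \<or> (real d + 1) / real n \<in> even_Ints) \<and>
      \<not> ((real d - 1) / real n \<in> even_Ints \<and> (real d + 1) / real n \<in> even_Ints) \<longrightarrow>
        (\<forall>r::nat. even r \<and> real r \<in> {(real d - 1) / real n, (real d + 1) / real n} \<longrightarrow>
          (\<forall>a :: nat \<Rightarrow> complex.
             psi r a \<in> Rat r \<and>
             (real r = (real d - 1) / real n \<longrightarrow> a r \<noteq> 0) \<and>
             (real r = (real d + 1) / real n \<longrightarrow> a r = 0 \<and> a 0 \<noteq> 0) \<longrightarrow>
             phi_hat n r a \<in> Rat d \<and>
             antihol_aut (phi_hat n r a) (tau n) \<and>
             has_order (tau n) (2 * n))))"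
proof (intro conjI)
  have n: "n > 0" using assms(1) by simp
  have frac: "(real d - 1) / real n = real (d - 1) / real n"
             "(real d + 1) / real n = real (d + 1) / real n"
    using assms(2) by (simp_all add: of_nat_diff)
  note even_iff = frac even_Ints_quotient_iff[OF n]
  have not_both: "\<not> (2 * n dvd d - 1 \<and> 2 * n dvd d + 1)"
    using not_both_dvd[OF assms(1,2)] by blast
  have quot: "real r = real m / real n \<longleftrightarrow> m = n * r" for r m :: nat
  proof -
    have "real r = real m / real n \<longleftrightarrow> real m = real (n * r)"
      using n by (auto simp: field_simps)
    then show ?thesis by (simp only: of_nat_eq_iff)
  qed
  have even_r: "2 * n dvd m" if "even r" "m = n * r" for r m :: nat
    using that by (auto simp: mult_dvd_mono)
  have cases: "d = n * r + 1 \<and> d + 1 \<noteq> n * r \<or> d + 1 = n * r \<and> d - 1 \<noteq> n * r"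
    if "real r \<in> {(real d - 1) / real n, (real d + 1) / real n}" for r :: nat
    using that assms(2) unfolding frac insert_iff quot by auto
  show "\<forall>\<phi> \<tau>. \<phi> \<in> Rat d \<and> antihol_aut \<phi> \<tau> \<and> has_order \<tau> (2 * n) \<longrightarrow>
        d \<ge> 3 \<and> odd d \<and>
        ((real d - 1) / real n \<in> even_Ints \<or> (real d + 1) / real n \<in> even_Ints) \<and>
        \<not> ((real d - 1) / real n \<in> even_Ints \<and> (real d + 1) / real n \<in> even_Ints) \<and>
        (\<forall>r::nat. even r \<and> real r \<in> {(real d - 1) / real n, (real d + 1) / real n} \<longrightarrow>
          (\<exists>T\<in>PSL2. \<exists>a :: nat \<Rightarrow> complex.
             T \<circ> \<phi> \<circ> inv T = phi_hat n r a \<and>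
             psi r a \<in> Rat r \<and>
             (real r = (real d - 1) / real n \<longrightarrow> a r \<noteq> 0) \<and>
             (real r = (real d + 1) / real n \<longrightarrow> a r = 0 \<and> a 0 \<noteq> 0) \<and>
             (\<exists>k. coprime k (2 * n) \<and> T \<circ> (\<tau> ^^ k) \<circ> inv T = tau n)))"
    (is "\<forall>\<phi> \<tau>. _ \<longrightarrow> ?C \<phi> \<tau>")
  proof (intro allI impI)
    fix \<phi> \<tau> assume "\<phi> \<in> Rat d \<and> antihol_aut \<phi> \<tau> \<and> has_order \<tau> (2 * n)"
    then obtain T k where T: "T \<in> PSL2" "coprime k (2 * n)" "T \<circ> \<tau> ^^ k \<circ> inv T = tau n"
      and Rat: "T \<circ> \<phi> \<circ> inv T \<in> Rat d"
      and comm: "(T \<circ> \<phi> \<circ> inv T) \<circ> tau n = tau n \<circ> (T \<circ> \<phi> \<circ> inv T)"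
      using antihol_aut_conj_form[OF assms(1,2,3)] by blast
    have C: "?C \<phi> \<tau>"
      if r: "even r" "d = n * r + 1 \<or> d + 1 = n * r"
        and hat: "T \<circ> \<phi> \<circ> inv T = phi_hat n r a" and psi: "psi r a \<in> Rat r"
        and i: "d = n * r + 1 \<Longrightarrow> a r \<noteq> 0" and ii: "d + 1 = n * r \<Longrightarrow> a r = 0 \<and> a 0 \<noteq> 0" for r a
    proof (intro conjI allI impI)
      have dvd: "2 * n dvd d - 1 \<or> 2 * n dvd d + 1"
        using r(2)
      proof
        assume "d = n * r + 1"
        then have "d - 1 = n * r" by simp
        with even_r[OF r(1)] show ?thesis by blast
      next
        assume "d + 1 = n * r"
        with even_r[OF r(1)] show ?thesis by blast
      qed
      have "even (n * r)" using r(1) by simp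
      then show odd: "odd d" using r(2) by (auto simp del: even_mult_iff dest: arg_cong[of _ _ even])
      then show "d \<ge> 3" using assms(2) by (cases "d = 2") auto
      show "(real d - 1) / real n \<in> even_Ints \<or> (real d + 1) / real n \<in> even_Ints"
        unfolding even_iff by (rule dvd)
      show "\<not> ((real d - 1) / real n \<in> even_Ints \<and> (real d + 1) / real n \<in> even_Ints)"
        unfolding even_iff by (rule not_both)
      fix r' assume r': "even r' \<and> real r' \<in> {(real d - 1) / real n, (real d + 1) / real n}"
      then have ev: "even r'" and *: "d = n * r' + 1 \<and> d + 1 \<noteq> n * r' \<or> d + 1 = n * r' \<and> d - 1 \<noteq> n * r'"
        using cases by blast+
      have "r' = r"
      proof (rule ccontr)
        assume "r' \<noteq> r"
        with n have "n * r' \<noteq> n * r" by simp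
        with * r(2) consider "d - 1 = n * r'" "d + 1 = n * r" | "d - 1 = n * r" "d + 1 = n * r'"
          by linarith
        then show False using even_r[OF ev] even_r[OF r(1)] not_both by cases blast+
      qed
      have top: "d = n * r + 1" if "d - 1 = n * r" using that assms(2) by simp
      show "\<exists>T\<in>PSL2. \<exists>a :: nat \<Rightarrow> complex.
             T \<circ> \<phi> \<circ> inv T = phi_hat n r' a \<and>
             psi r' a \<in> Rat r' \<and>
             (real r' = (real d - 1) / real n \<longrightarrow> a r' \<noteq> 0) \<and>
             (real r' = (real d + 1) / real n \<longrightarrow> a r' = 0 \<and> a 0 \<noteq> 0) \<and>
             (\<exists>k. coprime k (2 * n) \<and> T \<circ> (\<tau> ^^ k) \<circ> inv T = tau n)"
        unfolding frac quot \<open>r' = r\<close>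
        using T(2,3) hat psi i[OF top] ii by (intro bexI[OF _ T(1)] exI[of _ a] conjI impI) blast+
    qed
    from assms(1,2) Rat comm show "?C \<phi> \<tau>"
    proof (cases rule: commuting_with_tau_form)
      case (top r a)
      then show ?thesis by (intro C[of r a]) simp_all
    next
      case (short r a)
      then show ?thesis by (intro C[of r a]) simp_all
    qed
  qed
  show "d \<ge> 3 \<and> odd d \<and>
      ((real d - 1) / real n \<in> even_Ints \<or> (real d + 1) / real n \<in> even_Ints) \<and>
      \<not> ((real d - 1) / real n \<in> even_Ints \<and> (real d + 1) / real n \<in> even_Ints) \<longrightarrow>
        (\<forall>r::nat. even r \<and> real r \<in> {(real d - 1) / real n, (real d + 1) / real n} \<longrightarrow>
          (\<forall>a :: nat \<Rightarrow> complex.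
             psi r a \<in> Rat r \<and>
             (real r = (real d - 1) / real n \<longrightarrow> a r \<noteq> 0) \<and>
             (real r = (real d + 1) / real n \<longrightarrow> a r = 0 \<and> a 0 \<noteq> 0) \<longrightarrow>
             phi_hat n r a \<in> Rat d \<and>
             antihol_aut (phi_hat n r a) (tau n) \<and>
             has_order (tau n) (2 * n)))"
  proof (intro impI allI, elim conjE)
    fix r :: nat and a :: "nat \<Rightarrow> complex"
    assume r: "even r" "real r \<in> {(real d - 1) / real n, (real d + 1) / real n}"
      and psi: "psi r a \<in> Rat r"
      and i: "real r = (real d - 1) / real n \<longrightarrow> a r \<noteq> 0"
      and ii: "real r = (real d + 1) / real n \<longrightarrow> a r = 0 \<and> a 0 \<noteq> 0"
    note i = i[unfolded frac quot] and ii = ii[unfolded frac quot]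
    have r0: "r > 0" using cases[OF r(2)] assms(2) by (cases r) auto
    have "a r \<noteq> 0 \<or> a 0 \<noteq> 0" using cases[OF r(2)] i ii by auto
    note cop = psi_in_Rat_imp_coprime[OF psi r0 this]
    have "phi_hat n r a \<in> Rat d \<and> phi_hat n r a \<circ> tau n = tau n \<circ> phi_hat n r a"
      using cases[OF r(2)] i ii phi_hat_commutes_tau[OF assms(1) r(1) r0 cop] by auto
    moreover have "tau n \<in> ext_moebius"
      by (simp add: tau_eq_anti_inversion anti_inversion_ext_moebius)
    ultimately show "phi_hat n r a \<in> Rat d \<and> antihol_aut (phi_hat n r a) (tau n) \<and> has_order (tau n) (2 * n)"
      using tau_has_order[OF n] by (simp add: antihol_aut_iff)
  qed
qed

end
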